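(* There exists a minimal subshift $(X,S)$ of topological rank $2$ such that $$\liminf_{n\to+\infty}\frac{p_X(n)}{n}=+\infty\quad\text{and}\quad\lim_{n\to+\infty}\frac{p_X(n)}{n^2}=0.$$
   Context: $S$ is the shift map; $p_X(n)$ is the number of words of length $n$ occurring in elements of $X$. Topological rank. Let $(X,T)$ be a minimal Cantor system (minimal homeomorphism of a Cantor set). A clopen Kakutani-Rohlin (CKR) partition of $X$ is a partition $\mathcal T=\{T^{-j}B(k):1\le k\le d,\ 0\le j<h(k)\}$ of $X$, where $B(1),\dots,B(d)$ are clopen, $h(k)\geq 1$ and $\bigcup_k T^{-h(k)}B(k)=\bigcup_k B(k)$; its base is $B(\mathcal T)=\bigcup_k B(k)$, and it has $d$ towers $\mathcal T(k)=\{T^{-j}B(k):0\le j<h(k)\}$. A sequence $(\mathcal T_n)_{n\ge0}$ of CKR partitions, $\mathcal T_n=\{T^{-j}B_n(k):1\le k\le d_n,0\le j<h_n(k)\}$, $\mathcal T_0=\{X\}$, is nested if for all $n$: $B(\mathcal T_{n+1})\subseteq B(\mathcal T_n)$; $\mathcal T_{n+1}$ refines $\mathcal T_n$; $\bigcap_n B(\mathcal T_n)$ is a single point; and the partitions $\mathcal T_n$ span the topology of $X$. It is primitive if for every $n\ge1$ there is $N>n$ such that every tower of $\mathcal T_N$ crosses every tower of $\mathcal T_n$ (i.e. the points of each $T^{-(h_N(k)-1)}B_N(k)$, iterated by $T$ until reaching $B_N(k)$, completely cross all towers of $\mathcal T_n$). The system has finite topological rank if it admits a primitive nested sequence of CKR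 partitions with $d_n\le d$ for all $n$, for some $d$ (equivalently, a Bratteli-Vershik representation with at most $d$ vertices per level); the minimum such $d$ is its topological rank. *)

theory Defs
  imports "HOL-Analysis.Analysis"
begin

section \<open>Minimal Cantor systems\<close>

text \<open>A Cantor set is a nonempty compact metrizable space with a basis of clopen sets and without
  isolated points.\<close>

definition cantor_space :: "'a topology \<Rightarrow> bool" where
  "cantor_space X \<longleftrightarrow>
     topspace X \<noteq> {} \<and> compact_space X \<and> metrizable_space X \<and>
     (\<forall>U x. openin X U \<and> x \<in> U \<longrightarrow> (\<exists>V. openin X V \<and> closedin X V \<and> x \<in> V \<and> V \<subseteq> U)) \<and>
     (\<forall>x\<in>topspace X. \<not> openin X {x})"

definition minimal_system :: "'a topology \<Rightarrow> ('a \<Rightarrow> 'a) \<Rightarrow> bool" where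
  "minimal_system X T \<longleftrightarrow>
     topspace X \<noteq> {} \<and> homeomorphic_map X X T \<and>
     (\<forall>C. closedin X C \<and> T ` C \<subseteq> C \<longrightarrow> C = {} \<or> C = topspace X)"

definition minimal_cantor_system :: "'a topology \<Rightarrow> ('a \<Rightarrow> 'a) \<Rightarrow> bool" where
  "minimal_cantor_system X T \<longleftrightarrow> cantor_space X \<and> minimal_system X T"


section \<open>Clopen Kakutani-Rohlin partitions\<close>

text \<open>The data of a partition; only the values of \<open>base\<close> and \<open>height\<close> at the indices
  \<open>1, \<dots>, ntowers\<close> are relevant.\<close>

record 'a kr =
  ntowers :: nat
  base :: "nat \<Rightarrow> 'a set"
  height :: "nat \<Rightarrow> nat"

definition iterate_vimage :: "'a topology \<Rightarrow> ('a \<Rightarrow> 'a) \<Rightarrow> nat \<Rightarrow> 'a set \<Rightarrow> 'a set" where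
  "iterate_vimage X T j B = {x \<in> topspace X. (T ^^ j) x \<in> B}"

definition kr_base :: "'a kr \<Rightarrow> 'a set" where
  "kr_base P = (\<Union>k\<in>{1..ntowers P}. base P k)"

definition kr_indices :: "'a kr \<Rightarrow> (nat \<times> nat) set" where
  "kr_indices P = {(k, j). 1 \<le> k \<and> k \<le> ntowers P \<and> j < height P k}"

definition kr_atoms :: "'a topology \<Rightarrow> ('a \<Rightarrow> 'a) \<Rightarrow> 'a kr \<Rightarrow> 'a set set" where
  "kr_atoms X T P = (\<lambda>(k, j). iterate_vimage X T j (base P k)) ` kr_indices P"

text \<open>Being a partition includes that the atoms are nonempty (equivalently, as \<open>T\<close> is a bijection,
  that the bases are) and that distinct pairs of indices give disjoint atoms.\<close>

definition ckr_partition :: "'a topology \<Rightarrow> ('a \<Rightarrow> 'a) \<Rightarrow> 'a kr \<Rightarrow> bool" where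
  "ckr_partition X T P \<longleftrightarrow>
     (\<forall>k\<in>{1..ntowers P}. openin X (base P k) \<and> closedin X (base P k) \<and>
        base P k \<noteq> {} \<and> 1 \<le> height P k) \<and>
     disjoint_family_on (\<lambda>(k, j). iterate_vimage X T j (base P k)) (kr_indices P) \<and>
     \<Union> (kr_atoms X T P) = topspace X \<and>
     (\<Union>k\<in>{1..ntowers P}. iterate_vimage X T (height P k) (base P k)) = kr_base P"

definition nested_ckr :: "'a topology \<Rightarrow> ('a \<Rightarrow> 'a) \<Rightarrow> (nat \<Rightarrow> 'a kr) \<Rightarrow> bool" where
  "nested_ckr X T P \<longleftrightarrow>
     (\<forall>n. ckr_partition X T (P n)) \<and>
     kr_atoms X T (P 0) = {topspace X} \<and>
     (\<forall>n. kr_base (P (Suc n)) \<subseteq> kr_base (P n)) \<and>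
     (\<forall>n. \<forall>U\<in>kr_atoms X T (P (Suc n)). \<exists>V\<in>kr_atoms X T (P n). U \<subseteq> V) \<and>
     (\<exists>x. (\<Inter>n. kr_base (P n)) = {x}) \<and>
     topology_generated_by (\<Union>n. kr_atoms X T (P n)) = X"

text \<open>Tower \<open>k\<close> of \<open>Q\<close> crosses tower \<open>l\<close> of \<open>P\<close>: the orbit of every point \<open>x\<close> of the last
  level of the former, which reaches the base at time \<open>h - 1\<close> with \<open>h = height Q k\<close>, enters the
  last level of the latter at a time \<open>i\<close> that leaves room to run through all \<open>height P l\<close> levels
  at the times \<open>i, \<dots>, i + height P l - 1 \<le> h - 1\<close>.\<close>

definition tower_crosses :: "'a topology \<Rightarrow> ('a \<Rightarrow> 'a) \<Rightarrow> 'a kr \<Rightarrow> nat \<Rightarrow> 'a kr \<Rightarrow> nat \<Rightarrow> bool" where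
  "tower_crosses X T Q k P l \<longleftrightarrow>
     (\<forall>x\<in>iterate_vimage X T (height Q k - 1) (base Q k).
        \<exists>i. i + (height P l - 1) \<le> height Q k - 1 \<and>
            (T ^^ i) x \<in> iterate_vimage X T (height P l - 1) (base P l))"

definition primitive_ckr :: "'a topology \<Rightarrow> ('a \<Rightarrow> 'a) \<Rightarrow> (nat \<Rightarrow> 'a kr) \<Rightarrow> bool" where
  "primitive_ckr X T P \<longleftrightarrow>
     (\<forall>n\<ge>1. \<exists>N>n. \<forall>k\<in>{1..ntowers (P N)}. \<forall>l\<in>{1..ntowers (P n)}.
        tower_crosses X T (P N) k (P n) l)"

definition rank_at_most :: "'a topology \<Rightarrow> ('a \<Rightarrow> 'a) \<Rightarrow> nat \<Rightarrow> bool" where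
  "rank_at_most X T d \<longleftrightarrow>
     (\<exists>P. nested_ckr X T P \<and> primitive_ckr X T P \<and> (\<forall>n. ntowers (P n) \<le> d))"

definition finite_topological_rank :: "'a topology \<Rightarrow> ('a \<Rightarrow> 'a) \<Rightarrow> bool" where
  "finite_topological_rank X T \<longleftrightarrow> (\<exists>d. rank_at_most X T d)"

text \<open>Meaningful only for systems of finite topological rank.\<close>

definition topological_rank :: "'a topology \<Rightarrow> ('a \<Rightarrow> 'a) \<Rightarrow> nat" where
  "topological_rank X T = (LEAST d. rank_at_most X T d)"


section \<open>Subshifts\<close>

definition shift :: "(int \<Rightarrow> 'b) \<Rightarrow> (int \<Rightarrow> 'b)" where
  "shift x = (\<lambda>i. x (i + 1))"

definition full_shift :: "'b set \<Rightarrow> (int \<Rightarrow> 'b) topology" where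
  "full_shift A = product_topology (\<lambda>_. discrete_topology A) UNIV"

definition subshift :: "'b set \<Rightarrow> (int \<Rightarrow> 'b) set \<Rightarrow> bool" where
  "subshift A X \<longleftrightarrow> finite A \<and> closedin (full_shift A) X \<and> shift ` X = X"

definition words :: "(int \<Rightarrow> 'b) set \<Rightarrow> nat \<Rightarrow> 'b list set" where
  "words X n = {map (\<lambda>j. x (i + int j)) [0..<n] | x i. x \<in> X}"

definition complexity :: "(int \<Rightarrow> 'b) set \<Rightarrow> nat \<Rightarrow> nat" where
  "complexity X n = card (words X n)"

end

theory Submission
  imports Defs "HOL-Library.Sublist"
begin

text \<open>
  The subshift is generated by two sequences of words, a long one \<open>u\<close> and a short one \<open>v\<close>, with
  \<open>u' = u u v u v v u v v v \<dots> u v\<dots>v\<close> (the last run being very long) and \<open>v' = u u v v\<close>.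
  The factor \<open>u u\<close> marks the beginning of the primed words, so every point has a unique tiling by
  \<open>u\<close> and \<open>v\<close> at each level; this gives Kakutani-Rohlin partitions with two towers, and these are
  nested since primed words start with \<open>u\<close> and end with \<open>v\<close>.  One tower would force periodicity.

  The unequal lengths make the complexity superlinear: a word \<open>v\<dots>v u v\<dots>v\<close> with fewer copies of \<open>v\<close>
  on the left can be continued by \<open>u\<close> and by \<open>v\<close>, hence the number of right special words of
  length \<open>m\<close> is of order \<open>m / |v|\<close> as long as \<open>m\<close> is between a multiple of \<open>|v|\<close> and the length of
  the longest run, which exceeds a large multiple of \<open>|v'|\<close>.  Conversely, for
  \<open>|u| \<le> m \<le> |u'|\<close> every word of length \<open>m\<close> is a factor of some \<open>u' v'\<dots>v' u'\<close>, where it is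
  determined by a position and the length of a run of \<open>v\<close> or \<open>v'\<close>, so there are
  \<open>O(m\<^sup>2 / |v|)\<close> of them.
\<close>

section \<open>The blocks and their rigidity\<close>

text \<open>Letters are coded by booleans: \<open>False\<close> stands for the long word
  \<open>u\<close> and \<open>True\<close> for the short word \<open>v\<close> of the current level.
  The staircase is the part of \<open>u'\<close> after its first \<open>u\<close>.\<close>

primrec stair :: "nat \<Rightarrow> bool list" where
  "stair 0 = []"
| "stair (Suc a) = stair a @ False # replicate (Suc a) True"

definition stair_subst :: "nat \<Rightarrow> bool \<Rightarrow> bool list" where
  "stair_subst a c = (if c then [False, False, True, True] else False # stair a)"

text \<open>Both words of a level are produced at once, as a function of the letter, since the
  height of the next staircase depends on both lengths.\<close>

primrec block :: "nat \<Rightarrow> bool \<Rightarrow> nat list" where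
  "block 0 = (\<lambda>c. [if c then 1 else 0])"
| "block (Suc n) = (\<lambda>c. concat (map (block n)
     (stair_subst (4 * (n + 6) * (length (block n False) + length (block n True))) c)))"

text \<open>The factor 4 (n + 6) makes the longest run of the short block at level \<open>n\<close> at least
  \<open>2 (n + 4)\<close> times as long as the short block of the next level.\<close>

definition stair_len :: "nat \<Rightarrow> nat" where
  "stair_len n = 4 * (n + 6) * (length (block n False) + length (block n True))"

abbreviation expand :: "nat \<Rightarrow> bool list \<Rightarrow> nat list" where
  "expand n B \<equiv> concat (map (block n) B)"

lemma block_Suc: "block (Suc n) c = expand n (stair_subst (stair_len n) c)"
  by (simp add: stair_len_def)

declare block.simps(2) [simp del]

section \<open>Synchronization: where the marker \<open>u u\<close> can occur\<close>

lemma prefix_stair: "a \<le> b \<Longrightarrow> prefix (stair a) (stair b)"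
  by (induction b rule: dec_induct) (auto intro: prefix_order.trans)

lemma stair_ge2: "2 \<le> a \<Longrightarrow> \<exists>D. stair a = [False, True, False, True, True] @ D"
  using prefix_stair[of 2 a] by (auto simp: numeral_2_eq_2 prefix_def)

text \<open>Four letters suffice to recognize an image: the first three are common to both images,
  and the fourth equals the substituted letter.\<close>

lemma stair_subst_begin: "2 \<le> a \<Longrightarrow> \<exists>D. stair_subst a c = [False, False, True, c] @ D"
  using stair_ge2[of a] by (auto simp: stair_subst_def)

lemma successively_replicate_True: "successively (\<or>) (replicate k True)"
  by (induction k) (auto simp: successively_Cons hd_replicate)

lemma stair_ne: "0 < a \<Longrightarrow> stair a \<noteq> []"
  by (cases a) auto

lemma last_stair: "0 < a \<Longrightarrow> last (stair a)"
  by (cases a) (auto simp: replicate_append_same[symmetric])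

lemma successively_stair: "successively (\<or>) (stair a)"
proof (induction a)
  case (Suc a)
  have "successively (\<or>) (False # replicate (Suc a) True)"
    using successively_replicate_True[of "Suc a"] by (simp add: successively_Cons)
  then show ?case
    using Suc last_stair[of a] by (cases "a = 0") (auto simp: successively_append_iff)
qed auto

lemma last_stair_subst: "2 \<le> a \<Longrightarrow> last (stair_subst a c)"
  using last_stair[of a] stair_ne[of a] by (auto simp: stair_subst_def)

lemma stair_subst_ne: "stair_subst a c \<noteq> []"
  by (auto simp: stair_subst_def)

text \<open>\<open>successively (\<or>)\<close> excludes two adjacent letters \<open>False\<close>.
  So a double \<open>False\<close> inside an image can only sit at its very start.\<close>

lemma successively_tl_stair_subst: "successively (\<or>) (tl (stair_subst a c))"
  using successively_stair[of a] by (auto simp: stair_subst_def)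

text \<open>An image ends with \<open>True\<close> and has no double \<open>False\<close> after its
  first letter, so \<open>False False\<close> in a concatenation of images can only be the start of
  an image. The fourth letter then names the image.\<close>

lemma stair_subst_rigid:
  assumes "2 \<le> a" "concat (map (stair_subst a) B) = C @ [False, False, True, c] @ D"
  shows "\<exists>B1 B2. B = B1 @ c # B2 \<and> C = concat (map (stair_subst a) B1)"
  using assms(2)
proof (induction B arbitrary: C)
  case Nil
  then show ?case by simp
next
  case (Cons b B)
  obtain E where E: "stair_subst a b = [False, False, True, b] @ E"
    using stair_subst_begin[OF assms(1)] by blast
  show ?case
  proof (cases "C = []")
    case True
    then have "b = c" using Cons.prems E by simp
    then show ?thesis using True by (intro exI[of _ "[]"] exI[of _ B]) simp
  next
    case False
    show ?thesis
    proof (cases "length (stair_subst a b) \<le> length C")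
      case True
      then obtain C' where C': "C = stair_subst a b @ C'"
        using Cons.prems by (auto simp: append_eq_append_conv2)
      then have "concat (map (stair_subst a) B) = C' @ [False, False, True, c] @ D"
        using Cons.prems by simp
      from Cons.IH[OF this] obtain B1 B2
        where "B = B1 @ c # B2" "C' = concat (map (stair_subst a) B1)" by blast
      then show ?thesis using C' by (intro exI[of _ "b # B1"] exI[of _ B2]) simp
    next
      case le: False
      then obtain G where G: "stair_subst a b = C @ G" "G \<noteq> []"
        using Cons.prems by (auto simp: append_eq_append_conv2)
      have G': "G @ concat (map (stair_subst a) B) = [False, False, True, c] @ D"
        using Cons.prems G by simp
      \<comment> \<open>The rest \<open>G\<close> of the first image ends with \<open>True\<close>,
        so it cannot stop within the two letters \<open>False\<close> of the marker and contains
        both.\<close>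
      have "last G" using last_stair_subst[OF assms(1), of b] G by simp
      then obtain G2 where G2: "G = False # False # G2"
        using G' G(2) by (cases G; cases "tl G") (auto split: if_splits)
      have "tl (stair_subst a b) = tl C @ False # False # G2"
        using G(1) G2 False by simp
      then have False
        using successively_tl_stair_subst[of a b] by (simp add: successively_append_iff)
      then show ?thesis ..
    qed
  qed
qed

lemma block_ne [simp]: "block n c \<noteq> []"
  by (induction n arbitrary: c) (auto simp: block_Suc stair_subst_def)

lemma stair_len_ge2: "2 \<le> stair_len n"
proof -
  have "1 \<le> length (block n False) + length (block n True)" by (simp add: Suc_le_eq)
  then have "4 * (n + 6) * 1 \<le> stair_len n" unfolding stair_len_def by (intro mult_le_mono2)
  then show ?thesis by simp
qed

text \<open>Induction on the level. A block of level \<open>n + 1\<close> begins with four blocks of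
  level \<open>n\<close> coding \<open>False False True c\<close>; the induction hypothesis aligns
  them with the decomposition of level \<open>n\<close>, and \<open>stair_subst_rigid\<close> lifts
  the alignment by one level. This recognizability makes the tilings unique.\<close>

lemma block_rigid:
  assumes "expand n B = p @ block n c @ q"
  shows "\<exists>B1 B2. B = B1 @ c # B2 \<and> p = expand n B1 \<and> q = expand n B2"
proof -
  have "\<exists>B1 B2. B = B1 @ c # B2 \<and> p = expand n B1"
    using assms
  proof (induction n arbitrary: B p c q)
    case 0
    have *: "concat (map (block 0) B) = map (\<lambda>c. if c then 1 else (0::nat)) B" for B
      by (induction B) auto
    then have "map (\<lambda>c. if c then 1 else (0::nat)) B = p @ [if c then 1 else 0] @ q"
      using 0 by simp
    then obtain B1 b B2 where "B = B1 @ b # B2" "p = map (\<lambda>c. if c then 1 else (0::nat)) B1"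
      "(if b then 1 else 0) = (if c then 1 else (0::nat))"
      by (auto simp: map_eq_append_conv map_eq_Cons_conv)
    then show ?case using * by (auto split: if_splits)
  next
    case (Suc n)
    let ?a = "stair_len n"
    let ?B = "concat (map (stair_subst ?a) B)"
    have expand: "expand (Suc n) B = expand n (concat (map (stair_subst ?a) B))" for B
      by (induction B) (auto simp: block_Suc)
    obtain E where E: "stair_subst ?a c = [False, False, True, c] @ E"
      using stair_subst_begin[OF stair_len_ge2] by blast
    \<comment> \<open>An aligned occurrence at the very beginning has nothing before it, because
      blocks are nonempty. So the remaining blocks of the marker can be peeled off one after
      another.\<close>
    have step: "\<exists>D. C = d # D \<and> r = expand n D" if "expand n C = block n d @ r" for C d r
    proof -
      obtain B1 B2 where B: "C = B1 @ d # B2" "[] = expand n B1"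
        using Suc.IH[of C "[]" d r] \<open>expand n C = block n d @ r\<close> by auto
      then have "B1 = []" by auto
      then show ?thesis using B that by auto
    qed
    have "expand n ?B = p @ block n False @ block n False @ block n True @ block n c @ expand n E @ q"
      using Suc.prems unfolding expand[symmetric] by (simp add: block_Suc[of n c] E)
    moreover from this obtain C C' where C: "?B = C @ False # C'" "p = expand n C"
      using Suc.IH[of ?B p False] by blast
    ultimately have "expand n C' = block n False @ block n True @ block n c @ expand n E @ q"
      by simp
    then obtain D where "?B = C @ [False, False, True, c] @ D"
      using step C(1) by (metis append_Cons append_Nil)
    from stair_subst_rigid[OF stair_len_ge2 this] C(2) show ?case by (auto simp: expand)
  qed
  then obtain B1 B2 where "B = B1 @ c # B2" "p = expand n B1" by blast
  with assms show ?thesis by (intro exI[of _ B1] exI[of _ B2]) simp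
qed

section \<open>Nesting and lengths of the blocks\<close>

lemma block_expand: "n \<le> N \<Longrightarrow> \<exists>B. block N c = expand n B"
proof (induction N arbitrary: c rule: dec_induct)
  case base
  show ?case by (rule exI[of _ "[c]"]) simp
next
  case (step N)
  show ?case
  proof -
    obtain f where f: "\<And>c. block N c = expand n (f c)" using step.IH by metis
    have "expand N B = expand n (concat (map f B))" for B by (induction B) (auto simp: f)
    then show ?thesis by (metis block_Suc)
  qed
qed

lemma length_block_True_Suc:
  "length (block (Suc n) True) = 2 * length (block n False) + 2 * length (block n True)"
  by (simp add: block_Suc stair_subst_def)

lemma sublist_expand: "sublist B C \<Longrightarrow> sublist (expand n B) (expand n C)"
  unfolding sublist_def by (metis concat_append map_append)

lemma block_Suc_begin: "\<exists>q. block (Suc n) c = block n False @ q"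
  using stair_subst_begin[OF stair_len_ge2, of n c] by (auto simp: block_Suc)

lemma block_Suc_end: "\<exists>p. block (Suc n) c = p @ block n True"
proof -
  have "stair_subst (stair_len n) c = butlast (stair_subst (stair_len n) c) @ [True]"
    using last_stair_subst[OF stair_len_ge2, of n c] stair_subst_ne[of "stair_len n" c]
    by (metis append_butlast_last_id)
  then have "block (Suc n) c = expand n (butlast (stair_subst (stair_len n) c) @ [True])"
    by (metis block_Suc)
  then show ?thesis by simp
qed

text \<open>The first six letters \<open>u u v u v v\<close> of the long image already include those
  of \<open>u u v v\<close>.\<close>

lemma length_block_le: "length (block n True) \<le> length (block n False)"
proof (induction n)
  case (Suc n)
  obtain D where "stair (stair_len n) = [False, True, False, True, True] @ D"
    using stair_ge2[OF stair_len_ge2] by blast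
  then have "stair_subst (stair_len n) False = [False, False, True, False, True, True] @ D"
    by (simp add: stair_subst_def)
  then have "length (block (Suc n) False) \<ge> 2 * length (block n False) + 2 * length (block n True)"
    by (simp add: block_Suc)
  then show ?case by (simp add: length_block_True_Suc)
qed simp

lemma length_block_True_ge: "n < length (block n True)"
proof (induction n)
  case (Suc n)
  then show ?case using length_block_le[of n] by (simp add: length_block_True_Suc)
qed simp

lemma length_block_ge: "n < length (block n c)"
  using length_block_True_ge[of n] length_block_le[of n] by (cases c) auto

lemma sublist_block_Suc: "sublist (block n c) (block (Suc n) d)"
proof -
  obtain D where "stair_subst (stair_len n) d = [False, False, True, d] @ D"
    using stair_subst_begin[OF stair_len_ge2] by blast
  then have "sublist [c] (stair_subst (stair_len n) d)"
    by (cases c) (auto simp: sublist_Cons_right prefix_def)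
  from sublist_expand[OF this, of n] show ?thesis by (simp add: block_Suc)
qed

lemma sublist_block: "n < N \<Longrightarrow> sublist (block n c) (block N d)"
proof (induction N arbitrary: d)
  case (Suc N)
  then show ?case using sublist_block_Suc sublist_order.order_trans by (metis less_SucE)
qed simp

lemma set_block: "set (block n c) \<subseteq> {0, 1}"
  by (induction n arbitrary: c) (auto simp: block_Suc)


section \<open>The shift space and its tilings\<close>

definition window :: "(int \<Rightarrow> 'a) \<Rightarrow> int \<Rightarrow> nat \<Rightarrow> 'a list" where
  "window x i n = map (\<lambda>j. x (i + int j)) [0..<n]"

lemma length_window [simp]: "length (window x i n) = n"
  by (simp add: window_def)

lemma nth_window [simp]: "j < n \<Longrightarrow> window x i n ! j = x (i + int j)"
  by (simp add: window_def)

lemma window_eq_iff: "window x i n = w \<longleftrightarrow> length w = n \<and> (\<forall>j<n. w ! j = x (i + int j))"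
  by (auto simp: list_eq_iff_nth_eq)

lemma window_add: "window x i (m + n) = window x i m @ window x (i + int m) n"
  by (auto simp: window_eq_iff nth_append algebra_simps)

lemma window_split:
  assumes "window x i n = p @ w @ q"
  shows "window x (i + int (length p)) (length w) = w"
proof -
  have n: "n = length p + (length w + length q)" using assms length_window by (metis length_append)
  show ?thesis using assms unfolding n window_add by (auto simp: append_eq_append_conv)
qed

lemma sublist_window: "sublist (window x (i + int k) m) (window x i (k + m + r))"
  unfolding window_add by (auto simp: add.assoc)

lemma sublist_windowD:
  assumes "sublist w (window x i n)"
  shows "\<exists>k. k + length w \<le> n \<and> window x (i + int k) (length w) = w"
proof -
  obtain p q where pq: "window x i n = p @ w @ q" using assms by (auto simp: sublist_def)
  then have "n = length p + (length w + length q)" using length_window by (metis length_append)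
  then show ?thesis using window_split[OF pq] by (intro exI[of _ "length p"]) auto
qed

section \<open>The language, the shift space and its decomposition into blocks\<close>

definition stair_lang :: "nat list set" where
  "stair_lang = {w. \<exists>n. sublist w (block n False)}"

definition stair_shift :: "(int \<Rightarrow> nat) set" where
  "stair_shift = {x. \<forall>i n. window x i n \<in> stair_lang}"

lemma stair_lang_sublist: "sublist v w \<Longrightarrow> w \<in> stair_lang \<Longrightarrow> v \<in> stair_lang"
  unfolding stair_lang_def using sublist_order.order.trans by blast

lemma block_stair_lang: "block n c \<in> stair_lang"
  unfolding stair_lang_def using sublist_block[of n "Suc n" c False] by blast

text \<open>A word of the language also occurs in a block of arbitrarily high level, and such a
  block is a concatenation of blocks of level \<open>n\<close>.\<close>

lemma stair_lang_expand:
  assumes "w \<in> stair_lang"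
  shows "\<exists>B. sublist w (expand n B)"
proof -
  obtain m where m: "sublist w (block m False)" using assms by (auto simp: stair_lang_def)
  have "sublist w (block (Suc (max m n)) False)"
    using m sublist_block[of m "Suc (max m n)" False False] sublist_order.order.trans by fastforce
  moreover have "n \<le> Suc (max m n)" by simp
  ultimately show ?thesis using block_expand by metis
qed

lemma expand_cover:
  "i < length (expand n B) \<Longrightarrow>
   \<exists>B1 c B2. B = B1 @ c # B2 \<and> length (expand n B1) \<le> i \<and> i < length (expand n B1) + length (block n c)"
proof (induction B rule: rev_induct)
  case (snoc c B)
  show ?case
  proof (cases "i < length (expand n B)")
    case True
    then obtain B1 d B2 where "B = B1 @ d # B2"
      "length (expand n B1) \<le> i \<and> i < length (expand n B1) + length (block n d)"
      using snoc.IH by blast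
    then show ?thesis by (intro exI[of _ B1] exI[of _ d] exI[of _ "B2 @ [c]"]) simp
  next
    case False
    then show ?thesis using snoc.prems by (intro exI[of _ B] exI[of _ c] exI[of _ "[]"]) simp
  qed
qed simp

text \<open>By \<open>tile_exists\<close> and \<open>tile_unique\<close>, the occurrences marked by
  this predicate cut every point of the shift space into blocks of level \<open>n\<close> in exactly
  one way.\<close>

definition tile :: "nat \<Rightarrow> (int \<Rightarrow> nat) \<Rightarrow> int \<Rightarrow> bool \<Rightarrow> bool" where
  "tile n x p c \<longleftrightarrow> window x p (length (block n c)) = block n c"

text \<open>A window reaching the length of \<open>u\<close> to both sides of \<open>i\<close> is a
  factor of a concatenation of blocks. The block covering \<open>i\<close> is no longer than
  \<open>u\<close>, so it lies inside the window and is seen in \<open>x\<close>.\<close>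

lemma tile_exists:
  assumes "x \<in> stair_shift"
  shows "\<exists>p c. tile n x p c \<and> p \<le> i \<and> i < p + int (length (block n c))"
proof -
  let ?l = "length (block n False)"
  have "window x (i - int ?l) (?l + ?l) \<in> stair_lang" using assms by (simp add: stair_shift_def)
  from stair_lang_expand[OF this] obtain B ps ss
    where B: "expand n B = ps @ window x (i - int ?l) (?l + ?l) @ ss"
    by (metis sublist_def)
  have "length ps + ?l < length (expand n B)" unfolding B by simp
  from expand_cover[OF this] obtain B1 c B2 where c: "B = B1 @ c # B2"
    "length (expand n B1) \<le> length ps + ?l"
      "length ps + ?l < length (expand n B1) + length (block n c)"
    by blast
  have lc: "length (block n c) \<le> ?l" using length_block_le[of n] by (cases c) auto
  \<comment> \<open>The subtraction is not truncated: the covering block starts less than the length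
    of \<open>u\<close> before the centre, hence not before the window.\<close>
  define k where "k = length (expand n B1) - length ps"
  have k: "length (expand n B1) = length ps + k" "k \<le> ?l" "?l < k + length (block n c)"
    using c lc unfolding k_def by linarith+
  have "block n c ! j = x (i - int ?l + int k + int j)" if j: "j < length (block n c)" for j
  proof -
    have "block n c ! j = expand n B ! (length (expand n B1) + j)"
      unfolding c(1) using j by (simp add: nth_append)
    also have "\<dots> = x (i - int ?l + int (k + j))"
      unfolding B k using j k lc by (simp add: nth_append)
    finally show ?thesis by (simp add: algebra_simps)
  qed
  then have "tile n x (i - int ?l + int k) c" by (auto simp: tile_def window_eq_iff)
  moreover have "i - int ?l + int k \<le> i" "i < i - int ?l + int k + int (length (block n c))"
    using k by linarith+
  ultimately show ?thesis by blast
qed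

text \<open>Both occurrences lie in one window and thus in one concatenation of blocks.
  \<open>block_rigid\<close> aligns them with the same factorization, and two members of one
  factorization whose ranges overlap coincide.\<close>

lemma tile_unique_aux:
  assumes "x \<in> stair_shift" "tile n x p c" "tile n x q d" "p \<le> q" "q < p + int (length (block n c))"
  shows "p = q \<and> c = d"
proof -
  define k where "k = nat (q - p)"
  have q: "q = p + int k" and k: "k < length (block n c)" using assms k_def by auto
  define W where "W = window x p (k + length (block n d) + length (block n c))"
  have "W \<in> stair_lang" using assms by (simp add: stair_shift_def W_def)
  from stair_lang_expand[OF this] obtain B ps ss where B: "expand n B = ps @ W @ ss"
    by (metis sublist_def)
  have "\<exists>r. W = block n c @ r"
  proof -
    have "W = window x p (length (block n c) + (k + length (block n d)))"
      by (simp add: W_def algebra_simps)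
    then show ?thesis using assms(2) unfolding window_add tile_def by auto
  qed
  then obtain r where r: "W = block n c @ r" by blast
  have "\<exists>r. W = window x p k @ block n d @ r"
    using assms(3) unfolding W_def window_add tile_def q by auto
  then obtain s where s: "W = window x p k @ block n d @ s" by blast
  obtain B1 B2 where 1: "B = B1 @ c # B2" "ps = expand n B1"
    using block_rigid[of n B ps c "r @ ss"] B r by auto
  obtain C1 C2 where 2: "B = C1 @ d # C2" "ps @ window x p k = expand n C1"
    using block_rigid[of n B "ps @ window x p k" d "s @ ss"] B s by auto
  show ?thesis
  proof (cases "length C1 \<le> length B1")
    case True
    then obtain D where D: "B1 = C1 @ D" using 1 2 by (auto simp: append_eq_append_conv2)
    have "length (expand n D) + k = 0"
    proof -
      have "length ps + k = length (expand n C1)" using 2(2) by (metis length_append length_window)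
      moreover have "length ps = length (expand n C1) + length (expand n D)" using 1(2) D by simp
      ultimately show ?thesis by simp
    qed
    then have "D = []" "k = 0" by auto
    then show ?thesis using 1 2 D q by auto
  next
    case False
    then obtain E where E: "C1 = B1 @ E" "E \<noteq> []" "E @ d # C2 = c # B2"
      using 1 2 by (auto simp: append_eq_append_conv2)
    then obtain D where "C1 = B1 @ c # D" by (cases E) auto
    then have "length ps + k = length ps + length (block n c) + length (expand n D)"
      using 1 2 by (metis (no_types, lifting) add.assoc concat.simps(2) concat_append length_append
          length_window list.map(2) map_append)
    then show ?thesis using k by simp
  qed
qed

lemma tile_unique:
  assumes "x \<in> stair_shift" "tile n x p c" "tile n x q d"
    "p \<le> i" "i < p + int (length (block n c))" "q \<le> i" "i < q + int (length (block n d))"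
  shows "p = q \<and> c = d"
  using tile_unique_aux[OF assms(1,2,3)] tile_unique_aux[OF assms(1,3,2)] assms(4-) by linarith

section \<open>The point to which the bases shrink\<close>

lemma prefix_block: "n < m \<Longrightarrow> prefix (block n False) (block m c)"
proof (induction m arbitrary: c)
  case (Suc m)
  have "prefix (block m False) (block (Suc m) c)"
    using block_Suc_begin[of m c] by (auto simp: prefix_def)
  then show ?case using Suc by (metis less_SucE prefix_order.trans)
qed simp

lemma suffix_block: "n < m \<Longrightarrow> suffix (block n True) (block m c)"
proof (induction m arbitrary: c)
  case (Suc m)
  have "suffix (block m True) (block (Suc m) c)"
    using block_Suc_end[of m c] by (auto simp: suffix_def)
  then show ?case using Suc by (metis less_SucE suffix_order.trans)
qed simp

text \<open>The right half is the limit of the long blocks, which are prefixes of one another, and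
  the left half the limit of the short blocks, which are suffixes of one another. A block of level
  \<open>j\<close> has more than \<open>j\<close> letters, so level \<open>j\<close> can supply the
  letter at distance \<open>j\<close> from the cut. The cut is between 0 and 1 because the bases of
  the towers will consist of points with a tile ending at 0.\<close>

definition base_pt :: "int \<Rightarrow> nat" where
  "base_pt i = (if 1 \<le> i then block (nat (i - 1)) False ! nat (i - 1)
           else rev (block (nat (- i)) True) ! nat (- i))"

lemma base_pt_pos: assumes "j < length (block n False)" shows "base_pt (1 + int j) = block n False ! j"
proof -
  have *: "a < b \<Longrightarrow> j < length (block a False) \<Longrightarrow> block b False ! j = block a False ! j" for a b
    using prefix_block[of a b False] by (auto simp: prefix_def nth_append)
  have "block j False ! j = block n False ! j"
    using *[of j n] *[of n j] assms length_block_ge[of j False]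
      by (cases j n rule: linorder_cases) auto
  then show ?thesis by (simp add: base_pt_def)
qed

lemma base_pt_neg: assumes "j < length (block n True)" shows "base_pt (- int j) = rev (block n True) ! j"
proof -
  have *: "a < b \<Longrightarrow> j < length (block a True) \<Longrightarrow> rev (block b True) ! j = rev (block a True) ! j"
    for a b
    using suffix_block[of a b True] by (auto simp: suffix_def nth_append)
  have "rev (block j True) ! j = rev (block n True) ! j"
    using *[of j n] *[of n j] assms length_block_ge[of j True]
      by (cases j n rule: linorder_cases) auto
  then show ?thesis by (simp add: base_pt_def)
qed

lemma tile_base_pt_right: "tile n base_pt 1 False"
  by (simp add: tile_def window_eq_iff base_pt_pos)

lemma tile_base_pt_left: "tile n base_pt (1 - int (length (block n True))) True"
proof -
  let ?s = "length (block n True)"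
  have "block n True ! j = base_pt (1 - int ?s + int j)" if "j < ?s" for j
  proof -
    have "base_pt (- int (?s - 1 - j)) = rev (block n True) ! (?s - 1 - j)"
      using that by (intro base_pt_neg) auto
    also have "\<dots> = block n True ! j" using that by (simp add: rev_nth)
    also have "- int (?s - 1 - j) = 1 - int ?s + int j" using that by linarith
    finally show ?thesis by simp
  qed
  then show ?thesis by (auto simp: tile_def window_eq_iff)
qed

lemma block_TF_stair_lang: "block n True @ block n False \<in> stair_lang"
proof -
  obtain D where "stair_subst (stair_len n) False = [False, False] @ [True, False] @ D"
    using stair_subst_begin[OF stair_len_ge2, of n False] by auto
  then have "sublist [True, False] (stair_subst (stair_len n) False)" unfolding sublist_def by metis
  from sublist_expand[OF this, of n] have "sublist (block n True @ block n False) (block (Suc n) False)"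
    by (simp add: block_Suc)
  then show ?thesis using block_stair_lang stair_lang_sublist by blast
qed

text \<open>Each window lies in some \<open>v u\<close> around the cut, and \<open>v u\<close>
  occurs in the next long block.\<close>

lemma base_pt_stair_shift: "base_pt \<in> stair_shift"
proof -
  have "window base_pt i m \<in> stair_lang" for i m
  proof -
    define n where "n = nat (\<bar>i\<bar> + int m + 1)"
    let ?s = "length (block n True)" and ?l = "length (block n False)"
    have sl: "\<bar>i\<bar> + int m + 1 < int ?s" "\<bar>i\<bar> + int m + 1 < int ?l"
      using length_block_ge[of n True] length_block_ge[of n False] unfolding n_def by linarith+
    have W: "window base_pt (1 - int ?s) (?s + ?l) = block n True @ block n False"
      unfolding window_add
        using tile_base_pt_left[of n] tile_base_pt_right[of n] by (simp add: tile_def)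
    define k where "k = nat (i - (1 - int ?s))"
    have k: "i = 1 - int ?s + int k" "k + m \<le> ?s + ?l" using sl unfolding k_def by linarith+
    then obtain r where "?s + ?l = k + m + r" using le_Suc_ex by blast
    then have "sublist (window base_pt i m) (block n True @ block n False)"
      unfolding k(1) W[symmetric] using sublist_window by metis
    then show ?thesis using block_TF_stair_lang stair_lang_sublist by blast
  qed
  then show ?thesis by (simp add: stair_shift_def)
qed

text \<open>Every block of level \<open>n + 1\<close> contains \<open>block n False\<close>, hence
  \<open>w\<close>, and these blocks tile each point. This uniform recurrence yields minimality, the
  absence of isolated points and the description of the words.\<close>

lemma stair_lang_recurrent:
  assumes "w \<in> stair_lang"
  shows "\<exists>K. \<forall>x\<in>stair_shift. \<forall>i. \<exists>k\<le>K. window x (i + int k) (length w) = w"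
proof -
  obtain n where n: "sublist w (block n False)" using assms by (auto simp: stair_lang_def)
  let ?L = "length (block (Suc n) False)"
  have "\<exists>k\<le>2 * ?L. window x (i + int k) (length w) = w" if x: "x \<in> stair_shift" for x i
  proof -
    \<comment> \<open>Looking at the tile that covers \<open>i + ?L\<close> ensures that it starts
      after \<open>i\<close>, so \<open>nat (p - i)\<close> is the exact distance.\<close>
    obtain p c where pc: "tile (Suc n) x p c" "p \<le> i + int ?L"
      "i + int ?L < p + int (length (block (Suc n) c))" using tile_exists[OF x] by blast
    have lc: "length (block (Suc n) c) \<le> ?L" using length_block_le[of "Suc n"] by (cases c) auto
    have "sublist w (block (Suc n) c)" using n sublist_block_Suc sublist_order.order.trans by blast
    then obtain k where k: "k + length w \<le> length (block (Suc n) c)"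
      "window x (p + int k) (length w) = w"
      using sublist_windowD pc(1) unfolding tile_def by metis
    have "window x (i + int (nat (p - i) + k)) (length w) = w"
      using k pc lc by (simp add: add.assoc[symmetric])
    moreover have "nat (p - i) + k \<le> 2 * ?L" using k pc lc by linarith
    ultimately show ?thesis by blast
  qed
  then show ?thesis by blast
qed

lemma words_stair_shift: "words stair_shift n = {w \<in> stair_lang. length w = n}"
proof
  show "words stair_shift n \<subseteq> {w \<in> stair_lang. length w = n}"
    by (auto simp: words_def stair_shift_def window_def[symmetric])
  show "{w \<in> stair_lang. length w = n} \<subseteq> words stair_shift n"
  proof clarify
    fix w assume "w \<in> stair_lang" "n = length w"
    then obtain k where "window base_pt (0 + int k) (length w) = w"
      using stair_lang_recurrent base_pt_stair_shift by blast
    then show "w \<in> words stair_shift (length w)"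
      using base_pt_stair_shift unfolding words_def window_def[symmetric] mem_Collect_eq by metis
  qed
qed


section \<open>The Cantor system\<close>

lemma window_eqD:
  assumes "window x i n = window y i n" "i \<le> j" "j < i + int n"
  shows "x j = y j"
proof -
  have "window x i n ! nat (j - i) = window y i n ! nat (j - i)" by (simp only: assms(1))
  then show ?thesis using assms(2,3) by (simp add: nat_less_iff)
qed

lemma topspace_full_shift: "topspace (full_shift A) = {x. \<forall>i. x i \<in> A}"
  by (auto simp: full_shift_def)

text \<open>Stated for an arbitrary set of sequences over the alphabet, since it is applied both to
  the shift space and, for proving that space closed, to all sequences over
  \<open>{0, 1}\<close>.\<close>

lemma openin_subshift_iff:
  assumes X: "X \<subseteq> {x. \<forall>i. x i \<in> A}"
  shows "openin (subtopology (full_shift A) X) U \<longleftrightarrow>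
    U \<subseteq> X \<and> (\<forall>x\<in>U. \<exists>N::nat. \<forall>y\<in>X. (\<forall>i. \<bar>i\<bar> \<le> int N \<longrightarrow> y i = x i) \<longrightarrow> y \<in> U)"
    (is "?L \<longleftrightarrow> ?R")
proof
  assume ?L
  then obtain V where V: "openin (full_shift A) V" "U = V \<inter> X" by (auto simp: openin_subtopology)
  show ?R
  proof (intro conjI ballI)
    show "U \<subseteq> X" using V by blast
    fix x assume x: "x \<in> U"
    then obtain W where W: "finite {i. W i \<noteq> A}" "x \<in> Pi\<^sub>E UNIV W" "Pi\<^sub>E UNIV W \<subseteq> V"
      using V unfolding full_shift_def openin_product_topology_alt by auto
    \<comment> \<open>The inserted 0 covers the case of no restricted coordinate, where the maximum
      would be taken over the empty set.\<close>
    define N where "N = nat (Max (insert 0 (abs ` {i. W i \<noteq> A})))"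
    have N: "\<bar>i\<bar> \<le> int N" if "W i \<noteq> A" for i
    proof -
      have "\<bar>i\<bar> \<le> Max (insert 0 (abs ` {i. W i \<noteq> A}))" using W(1) that by (intro Max_ge) auto
      then show ?thesis unfolding N_def by linarith
    qed
    have "y \<in> U" if "y \<in> X" "\<forall>i. \<bar>i\<bar> \<le> int N \<longrightarrow> y i = x i" for y
    proof -
      have "y i \<in> W i" for i
        using W(2) N[of i] that X by (cases "W i = A") (auto simp: PiE_iff)
      then have "y \<in> Pi\<^sub>E UNIV W" by auto
      then show ?thesis using W(3) V that by blast
    qed
    then show "\<exists>N::nat. \<forall>y\<in>X. (\<forall>i. \<bar>i\<bar> \<le> int N \<longrightarrow> y i = x i) \<longrightarrow> y \<in> U" by blast
  qed
next
  assume R: ?R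
  show ?L
  proof (subst openin_subopen, intro ballI)
    fix x assume x: "x \<in> U"
    then obtain N :: nat where N: "\<forall>y\<in>X. (\<forall>i. \<bar>i\<bar> \<le> int N \<longrightarrow> y i = x i) \<longrightarrow> y \<in> U" using R by blast
    define W where "W = (\<lambda>i. if \<bar>i\<bar> \<le> int N then {x i} else A)"
    have xA: "x i \<in> A" for i using x R X by blast
    have "{i. \<bar>i\<bar> \<le> int N} \<subseteq> {- int N..int N}" by auto
    then have "finite {i. \<bar>i\<bar> \<le> int N}" using finite_subset by blast
    then have "finite {i. W i \<noteq> A}" by (rule finite_subset[rotated]) (auto simp: W_def)
    then have "openin (full_shift A) (Pi\<^sub>E UNIV W)"
      unfolding full_shift_def openin_PiE_gen using xA by (auto simp: W_def)
    then have "openin (subtopology (full_shift A) X) (Pi\<^sub>E UNIV W \<inter> X)"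
      by (auto simp: openin_subtopology)
    moreover have "x \<in> Pi\<^sub>E UNIV W \<inter> X" using x R xA by (auto simp: W_def)
    moreover have "Pi\<^sub>E UNIV W \<inter> X \<subseteq> U"
    proof
      fix y assume y: "y \<in> Pi\<^sub>E UNIV W \<inter> X"
      then have "y i \<in> W i" for i by auto
      then have "\<forall>i. \<bar>i\<bar> \<le> int N \<longrightarrow> y i = x i" unfolding W_def by (metis singletonD)
      then show "y \<in> U" using N y by blast
    qed
    ultimately show "\<exists>T. openin (subtopology (full_shift A) X) T \<and> x \<in> T \<and> T \<subseteq> U" by blast
  qed
qed

lemma stair_shift_letters: "stair_shift \<subseteq> {x. \<forall>i. x i \<in> {0, 1}}"
proof (intro subsetI CollectI allI)
  fix x i assume "x \<in> stair_shift"
  then have "window x i 1 \<in> stair_lang" by (simp add: stair_shift_def)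
  then obtain n where "sublist [x i] (block n False)" by (auto simp: stair_lang_def window_def)
  then show "x i \<in> {0, 1}" using set_mono_sublist set_block by fastforce
qed

definition stair_top :: "(int \<Rightarrow> nat) topology" where
  "stair_top = subtopology (full_shift {0, 1}) stair_shift"

lemmas openin_stair_top = openin_subshift_iff[OF stair_shift_letters, folded stair_top_def]

lemma topspace_stair_top [simp]: "topspace stair_top = stair_shift"
  unfolding stair_top_def topspace_subtopology topspace_full_shift
    using stair_shift_letters by blast

lemma closedin_stair_top:
  "closedin stair_top C \<longleftrightarrow>
    C \<subseteq> stair_shift \<and> (\<forall>y\<in>stair_shift. (\<forall>N::nat. \<exists>x\<in>C. \<forall>i. \<bar>i\<bar> \<le> int N \<longrightarrow> x i = y i) \<longrightarrow> y \<in> C)"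
proof -
  have "y \<notin> C \<longrightarrow> (\<exists>N::nat. \<forall>x\<in>stair_shift. (\<forall>i. \<bar>i\<bar> \<le> int N \<longrightarrow> x i = y i) \<longrightarrow> x \<in> stair_shift - C)
      \<longleftrightarrow> ((\<forall>N::nat. \<exists>x\<in>C. \<forall>i. \<bar>i\<bar> \<le> int N \<longrightarrow> x i = y i) \<longrightarrow> y \<in> C)"
    if "C \<subseteq> stair_shift" for y
    using that by (meson DiffD2 DiffI subsetD)
  then show ?thesis
    unfolding closedin_def openin_stair_top topspace_stair_top
      by (metis (no_types, lifting) Diff_iff Diff_subset)
qed

lemma clopen_local:
  assumes "\<And>x y. x \<in> stair_shift \<Longrightarrow> y \<in> stair_shift \<Longrightarrow> (\<forall>i. \<bar>i\<bar> \<le> int N \<longrightarrow> x i = y i) \<Longrightarrow> P x = P y"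
  shows "openin stair_top {x \<in> stair_shift. P x}" "closedin stair_top {x \<in> stair_shift. P x}"
proof -
  have *: "P y = P x" if "x \<in> stair_shift" "y \<in> stair_shift" "\<forall>i. \<bar>i\<bar> \<le> int N \<longrightarrow> y i = x i" for x y
    using assms[of y x] that by blast
  show "openin stair_top {x \<in> stair_shift. P x}" unfolding openin_stair_top
  proof (intro conjI ballI)
    fix x assume "x \<in> {x \<in> stair_shift. P x}"
    then show "\<exists>N::nat. \<forall>y\<in>stair_shift. (\<forall>i. \<bar>i\<bar> \<le> int N \<longrightarrow> y i = x i) \<longrightarrow> y \<in> {x \<in> stair_shift. P x}"
      using *[of x] by (intro exI[of _ N]) blast
  qed blast
  show "closedin stair_top {x \<in> stair_shift. P x}" unfolding closedin_stair_top
  proof (intro conjI ballI impI)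
    fix y assume y: "y \<in> stair_shift"
      "\<forall>N::nat. \<exists>x\<in>{x \<in> stair_shift. P x}. \<forall>i. \<bar>i\<bar> \<le> int N \<longrightarrow> x i = y i"
    then obtain x where "x \<in> stair_shift" "P x" "\<forall>i. \<bar>i\<bar> \<le> int N \<longrightarrow> x i = y i" by blast
    then show "y \<in> {x \<in> stair_shift. P x}" using *[of y x] y(1) by blast
  qed blast
qed

section \<open>The shift as a minimal homeomorphism\<close>

lemma window_shift: "window (shift x) i n = window x (i + 1) n"
  by (simp add: window_def shift_def algebra_simps)

lemma shift_pow: "(shift ^^ k) x i = x (i + int k)"
  by (induction k arbitrary: i) (auto simp: shift_def algebra_simps)

lemma window_shift_pow: "window ((shift ^^ k) x) i n = window x (i + int k) n"
  by (simp add: window_def shift_pow algebra_simps)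

lemma tile_shift_pow: "tile n ((shift ^^ k) x) p c \<longleftrightarrow> tile n x (p + int k) c"
  by (simp add: tile_def window_shift_pow)

lemma shift_stair_shift: "x \<in> stair_shift \<Longrightarrow> shift x \<in> stair_shift"
  by (auto simp: stair_shift_def window_shift)

lemma shift_pow_stair_shift: "x \<in> stair_shift \<Longrightarrow> (shift ^^ k) x \<in> stair_shift"
  by (induction k) (auto simp: shift_stair_shift)

definition unshift :: "(int \<Rightarrow> 'b) \<Rightarrow> (int \<Rightarrow> 'b)" where
  "unshift x = (\<lambda>i. x (i - 1))"

lemma shift_unshift [simp]: "shift (unshift x) = x" "unshift (shift x) = x"
  by (auto simp: shift_def unshift_def)

lemma unshift_stair_shift: "x \<in> stair_shift \<Longrightarrow> unshift x \<in> stair_shift"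
proof -
  have "window (unshift x) i n = window x (i - 1) n" for i n
    by (simp add: window_def unshift_def algebra_simps)
  then show "x \<in> stair_shift \<Longrightarrow> unshift x \<in> stair_shift" by (simp add: stair_shift_def)
qed

lemma shift_image_stair_shift: "shift ` stair_shift = stair_shift"
  using shift_stair_shift unshift_stair_shift by (auto simp: image_iff) (metis shift_unshift(1))

text \<open>A forbidden window of a sequence is visible in finitely many coordinates, hence excludes
  a whole cylinder.\<close>

lemma closedin_stair_shift: "closedin (full_shift {0, 1}) stair_shift"
proof -
  let ?Y = "{x :: int \<Rightarrow> nat. \<forall>i. x i \<in> {0, 1}}"
  have top: "topspace (full_shift {0, 1}) = ?Y"
    by (rule topspace_full_shift)
  then have "full_shift {0, 1} = subtopology (full_shift {0, 1}) ?Y"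
    by (metis subtopology_topspace)
  moreover have "openin (subtopology (full_shift {0, 1}) ?Y) (?Y - stair_shift)"
    unfolding openin_subshift_iff[OF order_refl]
  proof (intro conjI ballI)
    fix x assume "x \<in> ?Y - stair_shift"
    then obtain i n where x: "x \<in> ?Y" "window x i n \<notin> stair_lang" by (auto simp: stair_shift_def)
    have "y \<notin> stair_shift" if "\<forall>j. \<bar>j\<bar> \<le> int (nat (\<bar>i\<bar> + int n)) \<longrightarrow> y j = x j" for y
    proof -
      have "window y i n = window x i n" unfolding window_def using that by auto
      then show ?thesis unfolding stair_shift_def mem_Collect_eq using x(2) by metis
    qed
    then show "\<exists>N::nat. \<forall>y\<in>?Y. (\<forall>i. \<bar>i\<bar> \<le> int N \<longrightarrow> y i = x i) \<longrightarrow> y \<in> ?Y - stair_shift" by blast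
  qed blast
  ultimately show ?thesis unfolding closedin_def using top stair_shift_letters by metis
qed

lemma subshift_stair_shift: "subshift {0, 1} stair_shift"
  unfolding subshift_def using closedin_stair_shift shift_image_stair_shift by simp

lemma homeo_shift: "homeomorphic_map stair_top stair_top shift"
proof -
  have c1: "continuous_map stair_top stair_top shift"
  proof (rule continuous_map_openin_preimage_eq[THEN iffD2], intro conjI allI impI)
    show "shift \<in> topspace stair_top \<rightarrow> topspace stair_top" using shift_stair_shift by auto
    fix U assume U: "openin stair_top U"
    show "openin stair_top (topspace stair_top \<inter> shift -` U)"
      unfolding openin_stair_top
    proof (intro conjI ballI)
      fix x assume x: "x \<in> topspace stair_top \<inter> shift -` U"
      then obtain N :: nat where N: "\<forall>y\<in>stair_shift. (\<forall>i. \<bar>i\<bar> \<le> int N \<longrightarrow> y i = shift x i) \<longrightarrow> y \<in> U"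
        using U unfolding openin_stair_top by blast
      have "shift y \<in> U" if "y \<in> stair_shift" "\<forall>i. \<bar>i\<bar> \<le> int (Suc N) \<longrightarrow> y i = x i" for y
      proof -
        have "\<forall>i. \<bar>i\<bar> \<le> int N \<longrightarrow> shift y i = shift x i" using that(2) by (auto simp: shift_def)
        then show ?thesis using N shift_stair_shift that by blast
      qed
      then show "\<exists>N::nat. \<forall>y\<in>stair_shift. (\<forall>i. \<bar>i\<bar> \<le> int N \<longrightarrow> y i = x i) \<longrightarrow> y \<in> topspace stair_top \<inter> shift -` U"
        by (intro exI[of _ "Suc N"]) auto
    qed auto
  qed
  have c2: "continuous_map stair_top stair_top unshift"
  proof (rule continuous_map_openin_preimage_eq[THEN iffD2], intro conjI allI impI)
    show "unshift \<in> topspace stair_top \<rightarrow> topspace stair_top" using unshift_stair_shift by auto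
    fix U assume U: "openin stair_top U"
    show "openin stair_top (topspace stair_top \<inter> unshift -` U)"
      unfolding openin_stair_top
    proof (intro conjI ballI)
      fix x assume x: "x \<in> topspace stair_top \<inter> unshift -` U"
      then obtain N :: nat where N: "\<forall>y\<in>stair_shift. (\<forall>i. \<bar>i\<bar> \<le> int N \<longrightarrow> y i = unshift x i) \<longrightarrow> y \<in> U"
        using U unfolding openin_stair_top by blast
      have "unshift y \<in> U" if "y \<in> stair_shift" "\<forall>i. \<bar>i\<bar> \<le> int (Suc N) \<longrightarrow> y i = x i" for y
      proof -
        have "\<forall>i. \<bar>i\<bar> \<le> int N \<longrightarrow> unshift y i = unshift x i" using that(2) by (auto simp: unshift_def)
        then show ?thesis using N unshift_stair_shift that by blast
      qed
      then show "\<exists>N::nat. \<forall>y\<in>stair_shift. (\<forall>i. \<bar>i\<bar> \<le> int N \<longrightarrow> y i = x i) \<longrightarrow> y \<in> topspace stair_top \<inter> unshift -` U"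
        by (intro exI[of _ "Suc N"]) auto
    qed auto
  qed
  have "homeomorphic_maps stair_top stair_top shift unshift"
    using c1 c2 by (simp add: homeomorphic_maps_def)
  then show ?thesis by (rule homeomorphic_maps_map[THEN iffD1, THEN conjunct1])
qed

text \<open>A nonempty closed forward invariant set contains a forward orbit, which by uniform
  recurrence visits every cylinder.\<close>

lemma minimal_stair_shift: "minimal_system stair_top shift"
  unfolding minimal_system_def
proof (intro conjI allI impI)
  show "topspace stair_top \<noteq> {}" using base_pt_stair_shift by auto
  show "homeomorphic_map stair_top stair_top shift" by (rule homeo_shift)
  fix C assume C: "closedin stair_top C \<and> shift ` C \<subseteq> C"
  show "C = {} \<or> C = topspace stair_top"
  proof (cases "C = {}")
    case False
    then obtain x where x: "x \<in> C" by blast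
    have pow: "(shift ^^ k) x \<in> C" for k
      using C x by (induction k) auto
    have xX: "x \<in> stair_shift" using C x by (auto simp: closedin_stair_top)
    have "y \<in> C" if y: "y \<in> stair_shift" for y
    proof -
      have "\<exists>z\<in>C. \<forall>i. \<bar>i\<bar> \<le> int N \<longrightarrow> z i = y i" for N :: nat
      proof -
        let ?w = "window y (- int N) (2 * N + 1)"
        have "?w \<in> stair_lang" using y by (simp add: stair_shift_def)
        then obtain k where "window x (- int N + int k) (length ?w) = ?w"
          using stair_lang_recurrent xX by blast
        then have k: "window ((shift ^^ k) x) (- int N) (2 * N + 1) = ?w"
          by (simp add: window_shift_pow)
        have "(shift ^^ k) x i = y i" if "\<bar>i\<bar> \<le> int N" for i
          using window_eqD[OF k] that by simp
        then show ?thesis using pow by blast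
      qed
      then show ?thesis using C y by (auto simp: closedin_stair_top)
    qed
    then show ?thesis using C by (auto simp: closedin_stair_top)
  qed simp
qed

text \<open>By recurrence all words can be read in the periodic point, where the reading position
  matters only modulo the period. Unbounded complexity therefore excludes periodic points.\<close>

lemma periodic_complexity:
  assumes x: "x \<in> stair_shift" "(shift ^^ k) x = x" "0 < k"
  shows "complexity stair_shift n \<le> k"
proof -
  have per: "x (i + int k * m) = x i" for i m
  proof -
    have *: "x (i + int k) = x i" for i using x(2) shift_pow[of k x i] by simp
    show ?thesis
    proof (induction m rule: int_induct[where k=0])
      case (step1 m)
      then show ?case using *[of "i + int k * m"] by (simp add: algebra_simps)
    next
      case (step2 m)
      then show ?case using *[of "i + int k * (m - 1)"] by (simp add: algebra_simps)
    qed simp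
  qed
  have "words stair_shift n \<subseteq> (\<lambda>j. window x (int j) n) ` {..<k}"
  proof
    fix w assume "w \<in> words stair_shift n"
    then have w: "w \<in> stair_lang" "length w = n" by (auto simp: words_stair_shift)
    then obtain j where "window x (0 + int j) n = w" using stair_lang_recurrent x(1) by blast
    moreover have "window x (int j) n = window x (int (j mod k)) n"
    proof -
      have "int j = int (j mod k) + int k * int (j div k)"
        by (metis mod_mult_div_eq of_nat_add of_nat_mult)
      then have "x (int j + int i) = x (int (j mod k) + int i)" for i
        using per[of "int (j mod k) + int i" "int (j div k)"] by (simp add: algebra_simps)
      then show ?thesis by (simp add: window_def)
    qed
    ultimately show "w \<in> (\<lambda>j. window x (int j) n) ` {..<k}" using x(3) by auto
  qed
  then have "card (words stair_shift n) \<le> card ((\<lambda>j. window x (int j) n) ` {..<k})"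
    by (intro card_mono) auto
  also have "\<dots> \<le> k" using card_image_le[of "{..<k}"] by fastforce
  finally show ?thesis by (simp add: complexity_def)
qed

text \<open>An isolated point would return to its own cylinder, hence to itself, and would be
  periodic. Compactness and metrizability come from the full shift.\<close>

lemma cantor_stair_shift:
  assumes "\<forall>k. \<exists>n. k < complexity stair_shift n"
  shows "cantor_space stair_top"
  unfolding cantor_space_def
proof (intro conjI allI impI ballI)
  show "topspace stair_top \<noteq> {}" using base_pt_stair_shift by auto
  have "compact_space (full_shift {0, 1 :: nat})"
    unfolding full_shift_def compact_space_product_topology
    by (simp add: compact_space_discrete_topology)
  then show "compact_space stair_top"
    unfolding stair_top_def
      using closedin_stair_shift closedin_compact_space compact_space_subtopology by blast
  have "metrizable_space (full_shift {0, 1 :: nat})"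
    unfolding full_shift_def metrizable_space_product_topology by simp
  then show "metrizable_space stair_top"
    unfolding stair_top_def by (rule metrizable_space_subtopology)
next
  fix U x assume "openin stair_top U \<and> x \<in> U"
  then obtain N :: nat where N: "\<forall>y\<in>stair_shift. (\<forall>i. \<bar>i\<bar> \<le> int N \<longrightarrow> y i = x i) \<longrightarrow> y \<in> U"
    and x: "x \<in> stair_shift"
    unfolding openin_stair_top by blast
  let ?V = "{y \<in> stair_shift. \<forall>i. \<bar>i\<bar> \<le> int N \<longrightarrow> y i = x i}"
  have "openin stair_top ?V" "closedin stair_top ?V" by (rule clopen_local[of N], auto)+
  then show "\<exists>V. openin stair_top V \<and> closedin stair_top V \<and> x \<in> V \<and> V \<subseteq> U" using N x by blast
next
  fix x assume "x \<in> topspace stair_top"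
  then have x: "x \<in> stair_shift" by simp
  show "\<not> openin stair_top {x}"
  proof
    assume "openin stair_top {x}"
    then obtain N :: nat where N: "\<forall>y\<in>stair_shift. (\<forall>i. \<bar>i\<bar> \<le> int N \<longrightarrow> y i = x i) \<longrightarrow> y = x"
      unfolding openin_stair_top by blast
    let ?w = "window x (- int N) (2 * N + 1)"
    have "?w \<in> stair_lang" using x by (simp add: stair_shift_def)
    \<comment> \<open>Searching from one place further right makes the return time
      \<open>Suc k\<close> positive.\<close>
    then obtain k where "window x (- int N + 1 + int k) (length ?w) = ?w"
      using stair_lang_recurrent x by blast
    then have k: "window ((shift ^^ Suc k) x) (- int N) (2 * N + 1) = ?w"
      unfolding window_shift_pow by (simp add: algebra_simps)
    have "(shift ^^ Suc k) x i = x i" if "\<bar>i\<bar> \<le> int N" for i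
      using window_eqD[OF k] that by simp
    then have "(shift ^^ Suc k) x = x" using N shift_pow_stair_shift[OF x] by blast
    from periodic_complexity[OF x this] show False using assms by (meson not_le zero_less_Suc)
  qed
qed


section \<open>Kakutani-Rohlin partitions\<close>

text \<open>Coordinate \<open>j\<close> is the last one of a tile; for \<open>j\<close> below the
  block length this is the tile covering 0. So \<open>j\<close> counts the shifts until the tile
  ends at 0, in accordance with the levels \<open>T^{-j} B\<close> of a tower.\<close>

definition level :: "nat \<Rightarrow> bool \<Rightarrow> nat \<Rightarrow> (int \<Rightarrow> nat) set" where
  "level n c j = {x \<in> stair_shift. tile n x (int j + 1 - int (length (block n c))) c}"

text \<open>Tower 1 consists of the long blocks and tower 2 of the short ones.\<close>

definition stair_kr :: "nat \<Rightarrow> (int \<Rightarrow> nat) kr" where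
  "stair_kr n = (case n of
     0 \<Rightarrow> \<lparr>ntowers = 1, base = (\<lambda>_. stair_shift), height = (\<lambda>_. 1)\<rparr>
   | Suc m \<Rightarrow> \<lparr>ntowers = 2, base = (\<lambda>k. level m (k = 2) 0), height = (\<lambda>k. length (block m (k = 2)))\<rparr>)"

lemma stair_kr_0 [simp]: "ntowers (stair_kr 0) = 1"
  "base (stair_kr 0) k = stair_shift" "height (stair_kr 0) k = 1"
  by (auto simp: stair_kr_def)

lemma stair_kr_Suc [simp]:
  "ntowers (stair_kr (Suc m)) = 2" "base (stair_kr (Suc m)) k = level m (k = 2) 0"
  "height (stair_kr (Suc m)) k = length (block m (k = 2))"
  by (auto simp: stair_kr_def)

lemma iterate_vimage_level: "iterate_vimage stair_top shift j (level n c i) = level n c (i + j)"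
  by (auto simp: iterate_vimage_def level_def tile_shift_pow shift_pow_stair_shift algebra_simps)

lemma clopen_level: "openin stair_top (level n c 0)" "closedin stair_top (level n c 0)"
proof -
  have "tile n x (1 - int (length (block n c))) c = tile n y (1 - int (length (block n c))) c"
    if "\<forall>i. \<bar>i\<bar> \<le> int (length (block n c)) \<longrightarrow> x i = y i" for x y
  proof -
    have "window x (1 - int (length (block n c))) (length (block n c))
        = window y (1 - int (length (block n c))) (length (block n c))"
      unfolding window_def using that by auto
    then show ?thesis by (simp add: tile_def)
  qed
  then show "openin stair_top (level n c 0)" "closedin stair_top (level n c 0)"
    unfolding level_def by (auto intro!: clopen_local[of "length (block n c)"])
qed

lemma level_nonempty: "level n c 0 \<noteq> {}"
proof -
  obtain k where k: "window base_pt (0 + int k) (length (block n c)) = block n c"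
    using stair_lang_recurrent[OF block_stair_lang] base_pt_stair_shift by blast
  have "int (k + length (block n c) - 1) = int k + int (length (block n c)) - 1"
    using length_block_ge[of n c] by linarith
  then have "(shift ^^ (k + length (block n c) - 1)) base_pt \<in> level n c 0"
    using k
      by (simp add: level_def shift_pow_stair_shift base_pt_stair_shift tile_shift_pow) (simp add: tile_def)
  then show ?thesis by blast
qed

section \<open>Neighbouring tiles and tiles of different levels\<close>

lemma tile_next:
  assumes "x \<in> stair_shift" "tile n x p c"
  shows "\<exists>d. tile n x (p + int (length (block n c))) d"
proof -
  let ?i = "p + int (length (block n c))"
  obtain q d where q: "tile n x q d" "q \<le> ?i" "?i < q + int (length (block n d))"
    using tile_exists[OF assms(1)] by blast
  \<comment> \<open>Otherwise the tile covering \<open>?i\<close> would also cover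
    \<open>?i - 1\<close>, the last position of the given tile, and the two tiles would be
    equal.\<close>
  have "q = ?i"
  proof (rule ccontr)
    assume "q \<noteq> ?i"
    then have "p = q \<and> c = d"
      using tile_unique[OF assms q(1), of "?i - 1"] q length_block_ge[of n c] by linarith
    then show False using q by simp
  qed
  then show ?thesis using q by blast
qed

lemma tile_prev:
  assumes "x \<in> stair_shift" "tile n x p c"
  shows "\<exists>d. tile n x (p - int (length (block n d))) d"
proof -
  obtain q d where q: "tile n x q d" "q \<le> p - 1" "p - 1 < q + int (length (block n d))"
    using tile_exists[OF assms(1)] by blast
  have "q + int (length (block n d)) = p"
  proof (rule ccontr)
    assume "q + int (length (block n d)) \<noteq> p"
    then have "p = q \<and> c = d"
      using tile_unique[OF assms q(1), of p] q length_block_ge[of n c] by linarith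
    then show False using q by simp
  qed
  then have "q = p - int (length (block n d))" by simp
  then show ?thesis using q by blast
qed

lemma tile_sublist:
  assumes "tile n x p c" "block n c = q @ block m d @ r"
  shows "tile m x (p + int (length q)) d"
  using window_split[of x p _ q "block m d" r] assms by (metis tile_def)

lemma tile_Suc_begin: "tile (Suc n) x p c \<Longrightarrow> tile n x p False"
  using block_Suc_begin[of n c] tile_sublist[of "Suc n" x p c "[]"] by auto

lemma tile_Suc_end:
  assumes "tile (Suc n) x p c"
  shows "tile n x (p + int (length (block (Suc n) c)) - int (length (block n True))) True"
proof -
  obtain q where q: "block (Suc n) c = q @ block n True" using block_Suc_end by blast
  then show ?thesis using tile_sublist[of "Suc n" x p c q n True "[]"] assms by simp
qed

lemma tile_agree:
  assumes "tile n x p c" "tile n y p c" "p \<le> i" "i < p + int (length (block n c))"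
  shows "x i = y i"
  using window_eqD[of x p "length (block n c)" y i] assms by (simp add: tile_def)

text \<open>The tile covering 0 is fixed by the atom. Its neighbours are not, but the one before
  ends with \<open>v\<close> of level \<open>n\<close> and the one after begins with
  \<open>u\<close> of level \<open>n\<close>; both have more than \<open>n\<close> letters.\<close>

lemma level_agree:
  assumes "x \<in> level (Suc n) c j"
    "y \<in> level (Suc n) c j" "j < length (block (Suc n) c)" "\<bar>i\<bar> \<le> int n"
  shows "x i = y i"
proof -
  define p where "p = int j + 1 - int (length (block (Suc n) c))"
  let ?e = "p + int (length (block (Suc n) c))" and ?s = "int (length (block n True))"
  have t: "tile (Suc n) z p c" "z \<in> stair_shift" if "z \<in> {x, y}" for z
    using assms that by (auto simp: level_def p_def)
  have r: "tile n z ?e False" if "z \<in> {x, y}" for z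
    using tile_next[OF t(2)[OF that] t(1)[OF that]] tile_Suc_begin by blast
  have l: "tile n z (p - ?s) True" if "z \<in> {x, y}" for z
  proof -
    have "\<exists>d. tile (Suc n) z (p - int (length (block (Suc n) d))) d"
      using tile_prev[OF t(2)[OF that] t(1)[OF that]] .
    then obtain d where "tile (Suc n) z (p - int (length (block (Suc n) d))) d" ..
    from tile_Suc_end[OF this] show ?thesis by simp
  qed
  consider "i < p" | "p \<le> i" "i < ?e" | "?e \<le> i" by linarith
  then show ?thesis
  proof cases
    case 1
    then show ?thesis using tile_agree[OF l l, of x y i] assms(3,4) length_block_ge[of n True]
      unfolding p_def by simp
  next
    case 2
    then show ?thesis using tile_agree[OF t(1) t(1), of x y i] by simp
  next
    case 3
    then show ?thesis using tile_agree[OF r r, of x y i] assms(3,4) length_block_ge[of n False]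
      unfolding p_def by simp
  qed
qed

text \<open>The position of 0 inside a tile of level \<open>n + 1\<close> determines which
  constituent block of level \<open>n\<close> covers 0, and where.\<close>

lemma level_refine:
  assumes "j < length (block (Suc n) c)"
  shows "\<exists>d i. i < length (block n d) \<and> level (Suc n) c j \<subseteq> level n d i"
proof -
  let ?l = "length (block (Suc n) c)"
  \<comment> \<open>Levels count from the end of the tile, whereas \<open>expand_cover\<close>
    counts from its beginning.\<close>
  have "?l - 1 - j < length (expand n (stair_subst (stair_len n) c))"
    using assms by (simp add: block_Suc)
  from expand_cover[OF this] obtain B1 d B2 where B: "stair_subst (stair_len n) c = B1 @ d # B2"
    "length (expand n B1) \<le> ?l - 1 - j" "?l - 1 - j < length (expand n B1) + length (block n d)"
    by blast
  define i where "i = length (expand n B1) + length (block n d) + j - ?l"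
  have i: "int i = int (length (expand n B1)) + int (length (block n d)) + int j - int ?l"
    "i < length (block n d)"
    using B(2,3) assms unfolding i_def by linarith+
  have eq: "block (Suc n) c = expand n B1 @ block n d @ expand n B2" by (simp add: block_Suc B)
  have "level (Suc n) c j \<subseteq> level n d i"
  proof
    fix x assume "x \<in> level (Suc n) c j"
    then have "x \<in> stair_shift" "tile (Suc n) x (int j + 1 - int ?l) c" by (auto simp: level_def)
    moreover from tile_sublist[OF this(2) eq]
    have "tile n x (int i + 1 - int (length (block n d))) d"
      unfolding i by (simp add: algebra_simps)
    ultimately show "x \<in> level n d i" by (simp add: level_def)
  qed
  then show ?thesis using i by blast
qed

lemma kr_indices_Suc:
  "kr_indices (stair_kr (Suc n)) = {(k, j). (k = 1 \<or> k = 2) \<and> j < length (block n (k = 2))}"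
  by (auto simp: kr_indices_def)

lemma kr_atoms_Suc: "kr_atoms stair_top shift (stair_kr (Suc n)) = {level n c j | c j. j < length (block n c)}"
proof
  show "kr_atoms stair_top shift (stair_kr (Suc n)) \<subseteq> {level n c j | c j. j < length (block n c)}"
    by (auto simp: kr_atoms_def kr_indices_Suc iterate_vimage_level)
  show "{level n c j | c j. j < length (block n c)} \<subseteq> kr_atoms stair_top shift (stair_kr (Suc n))"
  proof clarify
    fix c j assume "j < length (block n c)"
    then show "level n c j \<in> kr_atoms stair_top shift (stair_kr (Suc n))"
      unfolding kr_atoms_def kr_indices_Suc
      by (intro image_eqI[of _ _ "(if c then 2 else 1, j)"]) (auto simp: iterate_vimage_level)
  qed
qed

lemma kr_base_Suc: "kr_base (stair_kr (Suc n)) = (\<Union>c. level n c 0)"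
proof -
  have "{1..2::nat} = {1, 2}" by auto
  then show ?thesis by (auto simp: kr_base_def UNIV_bool)
qed

lemma kr_atoms_0: "kr_atoms stair_top shift (stair_kr 0) = {stair_shift}"
proof -
  have "kr_indices (stair_kr 0) = {(1, 0)}" by (auto simp: kr_indices_def)
  then show ?thesis by (auto simp: kr_atoms_def iterate_vimage_def)
qed

text \<open>Existence and uniqueness of the tile covering 0 make the atoms cover the space and be
  disjoint. The return condition says that a tile starts at 1 exactly when one ends at 0.\<close>

lemma ckr_stair_kr: "ckr_partition stair_top shift (stair_kr n)"
proof (cases n)
  case 0
  have "kr_indices (stair_kr 0) = {(1, 0)}" by (auto simp: kr_indices_def)
  then have "disjoint_family_on (\<lambda>(k, j). iterate_vimage stair_top shift j (base (stair_kr 0) k)) (kr_indices (stair_kr 0))"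
    by (auto simp: disjoint_family_on_def)
  moreover have "stair_shift \<noteq> {}" "openin stair_top stair_shift" "closedin stair_top stair_shift"
    using base_pt_stair_shift openin_topspace[of stair_top] closedin_topspace[of stair_top] by auto
  moreover have "iterate_vimage stair_top shift 1 stair_shift = stair_shift"
    by (auto simp: iterate_vimage_def shift_stair_shift)
  ultimately show ?thesis
    unfolding 0 ckr_partition_def kr_atoms_0 by (simp add: stair_kr_def kr_base_def)
next
  case (Suc m)
  have two: "{1..ntowers (stair_kr (Suc m))} = {1, 2}" by auto
  have disj: "disjoint_family_on (\<lambda>(k, j). iterate_vimage stair_top shift j (base (stair_kr n) k)) (kr_indices (stair_kr n))"
    unfolding disjoint_family_on_def Suc kr_indices_Suc
  proof (intro ballI impI)
    fix a b :: "nat \<times> nat"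
    assume "a \<in> {(k, j). (k = 1 \<or> k = 2) \<and> j < length (block m (k = 2))}"
      "b \<in> {(k, j). (k = 1 \<or> k = 2) \<and> j < length (block m (k = 2))}" "a \<noteq> b"
    then obtain k i l j where ab: "a = (k, i)" "b = (l, j)"
      and kl: "k = 1 \<or> k = 2"
        "i < length (block m (k = 2))" "l = 1 \<or> l = 2" "j < length (block m (l = 2))"
      and ne: "(k, i) \<noteq> (l, j)" by auto
    have "level m (k = 2) i \<inter> level m (l = 2) j = {}"
    proof (rule ccontr)
      assume "level m (k = 2) i \<inter> level m (l = 2) j \<noteq> {}"
      then obtain x where "x \<in> stair_shift"
        and t: "tile m x (int i + 1 - int (length (block m (k = 2)))) (k = 2)"
        "tile m x (int j + 1 - int (length (block m (l = 2)))) (l = 2)" by (auto simp: level_def)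
      from tile_unique[OF this, of 0] kl have
        "int i + 1 - int (length (block m (k = 2))) = int j + 1 - int (length (block m (l = 2)))"
        "(k = 2) = (l = 2)" by linarith+
      then have "i = j" "k = l" using kl by auto
      then show False using ne by simp
    qed
    then show "(case a of (k, j) \<Rightarrow> iterate_vimage stair_top shift j (base (stair_kr (Suc m)) k)) \<inter>
       (case b of (k, j) \<Rightarrow> iterate_vimage stair_top shift j (base (stair_kr (Suc m)) k)) = {}"
      by (simp add: ab iterate_vimage_level)
  qed
  have cover: "\<Union> (kr_atoms stair_top shift (stair_kr n)) = topspace stair_top"
  proof
    show "\<Union> (kr_atoms stair_top shift (stair_kr n)) \<subseteq> topspace stair_top"
      unfolding Suc kr_atoms_Suc by (auto simp: level_def)
    show "topspace stair_top \<subseteq> \<Union> (kr_atoms stair_top shift (stair_kr n))"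
    proof
      fix x assume "x \<in> topspace stair_top"
      then have x: "x \<in> stair_shift" by simp
      then obtain p c where p: "tile m x p c" "p \<le> 0" "0 < p + int (length (block m c))"
        using tile_exists by blast
      define j where "j = nat (p + int (length (block m c)) - 1)"
      have "x \<in> level m c j" "j < length (block m c)" using p x by (auto simp: level_def j_def)
      then show "x \<in> \<Union> (kr_atoms stair_top shift (stair_kr n))" unfolding Suc kr_atoms_Suc by blast
    qed
  qed
  have "(\<Union>c. level m c (length (block m c))) = (\<Union>c. level m c 0)"
  proof (intro equalityI subsetI)
    fix x assume "x \<in> (\<Union>c. level m c (length (block m c)))"
    then obtain c where "x \<in> stair_shift" "tile m x 1 c" by (auto simp: level_def)
    from tile_prev[OF this] this show "x \<in> (\<Union>c. level m c 0)" by (auto simp: level_def)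
  next
    fix x assume "x \<in> (\<Union>c. level m c 0)"
    then obtain c where "x \<in> stair_shift" "tile m x (1 - int (length (block m c))) c"
      by (auto simp: level_def)
    from tile_next[OF this] this show "x \<in> (\<Union>c. level m c (length (block m c)))"
      by (auto simp: level_def)
  qed
  then have last: "(\<Union>k\<in>{1..ntowers (stair_kr n)}. iterate_vimage stair_top shift (height (stair_kr n) k) (base (stair_kr n) k)) = kr_base (stair_kr n)"
    unfolding Suc kr_base_Suc two by (simp add: iterate_vimage_level UNIV_bool Un_commute)
  show ?thesis
    unfolding ckr_partition_def
    using disj cover last clopen_level level_nonempty
    by (auto simp: Suc Suc_le_eq)
qed

text \<open>A block of the next level ends with \<open>v\<close>, so the end of a tile is also the
  end of a tile of the previous level.\<close>

lemma base_stair_kr_nested: "kr_base (stair_kr (Suc n)) \<subseteq> kr_base (stair_kr n)"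
proof (cases n)
  case 0
  have "kr_base (stair_kr 0) = stair_shift" by (simp add: kr_base_def)
  then show ?thesis unfolding 0 kr_base_Suc by (auto simp: level_def)
next
  case (Suc m)
  show ?thesis
    unfolding Suc kr_base_Suc
  proof clarify
    fix x c assume "x \<in> level (Suc m) c 0"
    then have "x \<in> stair_shift" "tile m x (1 - int (length (block m True))) True"
      using tile_Suc_end[of m x "1 - int (length (block (Suc m) c))" c] by (auto simp: level_def)
    then show "x \<in> (\<Union>c. level m c 0)" by (auto simp: level_def)
  qed
qed

text \<open>If a tile of level \<open>n + 1\<close> ends at 0, then \<open>v\<close> of level
  \<open>n\<close> ends at 0 and \<open>u\<close> of level \<open>n\<close> starts at 1, as in
  \<open>base_pt\<close>. This fixes all coordinates of absolute value at most
  \<open>n\<close>.\<close>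

lemma Inter_base_stair_kr: "(\<Inter>n. kr_base (stair_kr n)) = {base_pt}"
proof
  have "base_pt \<in> level n True 0" for n
    using base_pt_stair_shift tile_base_pt_left by (simp add: level_def)
  moreover have "kr_base (stair_kr 0) = stair_shift" by (simp add: kr_base_def)
  ultimately have "base_pt \<in> kr_base (stair_kr n)" for n
    using base_pt_stair_shift by (cases n) (auto simp: kr_base_Suc)
  then show "{base_pt} \<subseteq> (\<Inter>n. kr_base (stair_kr n))" by blast
  show "(\<Inter>n. kr_base (stair_kr n)) \<subseteq> {base_pt}"
  proof
    fix x assume x: "x \<in> (\<Inter>n. kr_base (stair_kr n))"
    have "x i = base_pt i" for i
    proof -
      define n where "n = nat \<bar>i\<bar>"
      have "x \<in> kr_base (stair_kr (Suc (Suc n)))" using x by blast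
      then obtain c where c: "x \<in> stair_shift"
        "tile (Suc n) x (1 - int (length (block (Suc n) c))) c"
        by (auto simp: kr_base_Suc level_def)
      have l: "tile n x (1 - int (length (block n True))) True"
        using tile_Suc_end[OF c(2)] by simp
      have r: "tile n x 1 False" using tile_next[OF c] tile_Suc_begin by fastforce
      show ?thesis
      proof (cases "1 \<le> i")
        case True
        then show ?thesis
          using tile_agree[OF r tile_base_pt_right] length_block_ge[of n False] by (simp add: n_def)
      next
        case False
        then show ?thesis
          using tile_agree[OF l tile_base_pt_left] length_block_ge[of n True] by (simp add: n_def)
      qed
    qed
    then show "x \<in> {base_pt}" by auto
  qed
qed

lemma atoms_open: "V \<in> kr_atoms stair_top shift (stair_kr n) \<Longrightarrow> openin stair_top V"
proof (cases n)
  case 0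
  then show "V \<in> kr_atoms stair_top shift (stair_kr n) \<Longrightarrow> openin stair_top V"
    using openin_topspace[of stair_top] by (auto simp: kr_atoms_0)
next
  case (Suc m)
  have "openin stair_top (level m c j)" for c j
  proof -
    have "openin stair_top {x \<in> topspace stair_top. (shift ^^ j) x \<in> level m c 0}"
    proof (rule openin_continuous_map_preimage)
      show "continuous_map stair_top stair_top (shift ^^ j)"
      proof (induction j)
        case (Suc j)
        then show ?case using homeo_shift
          by (auto intro: continuous_map_compose homeomorphic_imp_continuous_map simp del: comp_apply)
      qed (simp add: id_def)
    qed (rule clopen_level)
    then show ?thesis
      using iterate_vimage_level[of j m c 0] by (simp add: iterate_vimage_def)
  qed
  then show "V \<in> kr_atoms stair_top shift (stair_kr n) \<Longrightarrow> openin stair_top V"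
    by (auto simp: Suc kr_atoms_Suc)
qed

text \<open>The atoms are open, and by \<open>level_agree\<close> the atom of a point for the tiles
  of level \<open>Suc N\<close> lies in its cylinder of radius \<open>N\<close>.\<close>

lemma generated_stair_top: "topology_generated_by (\<Union>n. kr_atoms stair_top shift (stair_kr n)) = stair_top"
  unfolding topology_eq
proof (intro allI iffI)
  fix U assume "openin (topology_generated_by (\<Union>n. kr_atoms stair_top shift (stair_kr n))) U"
  then have "generate_topology_on (\<Union>n. kr_atoms stair_top shift (stair_kr n)) U"
    by (rule openin_topology_generated_by)
  then show "openin stair_top U"
    by induction (auto intro: atoms_open)
next
  fix U assume U: "openin stair_top U"
  show "openin (topology_generated_by (\<Union>n. kr_atoms stair_top shift (stair_kr n))) U"
  proof (subst openin_subopen, intro ballI)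
    fix x assume "x \<in> U"
    then obtain N :: nat where N: "\<forall>y\<in>stair_shift. (\<forall>i. \<bar>i\<bar> \<le> int N \<longrightarrow> y i = x i) \<longrightarrow> y \<in> U"
      and x: "x \<in> stair_shift"
      using U unfolding openin_stair_top by blast
    have "x \<in> \<Union> (kr_atoms stair_top shift (stair_kr (Suc (Suc N))))"
      using ckr_stair_kr[of "Suc (Suc N)"] x by (simp add: ckr_partition_def)
    then obtain c j where j: "x \<in> level (Suc N) c j" "j < length (block (Suc N) c)"
      unfolding kr_atoms_Suc by blast
    have "level (Suc N) c j \<in> kr_atoms stair_top shift (stair_kr (Suc (Suc N)))"
      using j unfolding kr_atoms_Suc by blast
    then have "openin (topology_generated_by (\<Union>n. kr_atoms stair_top shift (stair_kr n))) (level (Suc N) c j)"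
      by (intro topology_generated_by_Basis) blast
    moreover have "level (Suc N) c j \<subseteq> U"
    proof
      fix y assume y: "y \<in> level (Suc N) c j"
      then have "y \<in> stair_shift" by (simp add: level_def)
      then show "y \<in> U" using N level_agree[OF y j(1) j(2)] by blast
    qed
    ultimately show "\<exists>T. openin (topology_generated_by (\<Union>n. kr_atoms stair_top shift (stair_kr n))) T \<and> x \<in> T \<and> T \<subseteq> U"
      using j by blast
  qed
qed

lemma nested_stair_kr: "nested_ckr stair_top shift stair_kr"
  unfolding nested_ckr_def
proof (intro conjI allI ballI)
  fix n U assume U: "U \<in> kr_atoms stair_top shift (stair_kr (Suc n))"
  then obtain c j where cj: "U = level n c j" "j < length (block n c)"
    unfolding kr_atoms_Suc by blast
  show "\<exists>V\<in>kr_atoms stair_top shift (stair_kr n). U \<subseteq> V"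
  proof (cases n)
    case 0
    then show ?thesis using cj by (auto simp: kr_atoms_0 level_def)
  next
    case (Suc m)
    then show ?thesis using level_refine[of j m c] cj by (fastforce simp: kr_atoms_Suc)
  qed
qed (use ckr_stair_kr kr_atoms_0 base_stair_kr_nested Inter_base_stair_kr generated_stair_top in auto)

text \<open>The very next partition works, since each block contains both blocks of the previous
  level. The last level of a tower consists of the points with a tile starting at 0, and crossing a
  tower means reading a full block.\<close>

lemma primitive_stair_kr: "primitive_ckr stair_top shift stair_kr"
  unfolding primitive_ckr_def
proof (intro allI impI)
  fix n :: nat assume "1 \<le> n"
  then obtain m where m: "n = Suc m" by (cases n) auto
  have "tower_crosses stair_top shift (stair_kr (Suc n)) k (stair_kr n) l" for k l
    unfolding tower_crosses_def
  proof
    let ?c = "k = 2" and ?d = "l = 2"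
    fix x assume "x \<in> iterate_vimage stair_top shift (height (stair_kr (Suc n)) k - 1) (base (stair_kr (Suc n)) k)"
    moreover have len: "1 \<le> length (block n ?c)" "1 \<le> length (block m ?d)" by (auto simp: Suc_le_eq)
    ultimately have "x \<in> level (Suc m) ?c (length (block (Suc m) ?c) - 1)"
      by (simp add: m iterate_vimage_level)
    then have x: "x \<in> stair_shift" "tile (Suc m) x 0 ?c"
      using len by (simp_all add: m level_def of_nat_diff)
    obtain i where i: "i + length (block m ?d) \<le> length (block (Suc m) ?c)"
      "tile m x (0 + int i) ?d"
      using sublist_windowD[of "block m ?d" x 0 "length (block (Suc m) ?c)"] x(2)
        sublist_block_Suc[of m ?d ?c] unfolding tile_def by metis
    then have "(shift ^^ i) x \<in> level m ?d (length (block m ?d) - 1)"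
      using x len by (simp add: level_def shift_pow_stair_shift tile_shift_pow of_nat_diff)
    then show "\<exists>i. i + (height (stair_kr n) l - 1) \<le> height (stair_kr (Suc n)) k - 1 \<and>
          (shift ^^ i) x \<in> iterate_vimage stair_top shift (height (stair_kr n) l - 1) (base (stair_kr n) l)"
      using i len by (intro exI[of _ i]) (auto simp: m iterate_vimage_level)
  qed
  then show "\<exists>N>n. \<forall>k\<in>{1..ntowers (stair_kr N)}. \<forall>l\<in>{1..ntowers (stair_kr n)}.
        tower_crosses stair_top shift (stair_kr N) k (stair_kr n) l" by blast
qed

lemma rank_at_most_2: "rank_at_most stair_top shift 2"
proof -
  have "ntowers (stair_kr n) \<le> 2" for n by (cases n) auto
  then show ?thesis unfolding rank_at_most_def using nested_stair_kr primitive_stair_kr by blast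
qed


section \<open>The rank is not one\<close>

lemma kr_atoms_unique:
  assumes "ckr_partition X T P" "U \<in> kr_atoms X T P" "V \<in> kr_atoms X T P" "x \<in> U" "x \<in> V"
  shows "U = V"
proof -
  let ?A = "\<lambda>(k, j). iterate_vimage X T j (base P k)"
  obtain a b where "a \<in> kr_indices P" "b \<in> kr_indices P" "U = ?A a" "V = ?A b"
    using assms(2,3) unfolding kr_atoms_def by (elim imageE)
  moreover have "disjoint_family_on ?A (kr_indices P)"
    using assms(1) by (simp add: ckr_partition_def)
  ultimately show ?thesis
    using assms(4,5) unfolding disjoint_family_on_def by (metis disjoint_iff)
qed

lemma nested_ckr_refine:
  assumes "nested_ckr X T P" "n \<le> N" "U \<in> kr_atoms X T (P N)"
  shows "\<exists>V\<in>kr_atoms X T (P n). U \<subseteq> V"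
  using assms(2,3)
proof (induction N arbitrary: U rule: dec_induct)
  case base
  then show ?case by (intro bexI[of _ U] order_refl)
next
  case (step N)
  have "\<forall>U\<in>kr_atoms X T (P (Suc N)). \<exists>V\<in>kr_atoms X T (P N). U \<subseteq> V"
    using assms(1) by (simp add: nested_ckr_def)
  then obtain V where "V \<in> kr_atoms X T (P N)" "U \<subseteq> V" using step.prems by blast
  moreover obtain W where "W \<in> kr_atoms X T (P n)" "V \<subseteq> W"
    using step.IH[OF calculation(1)] by blast
  ultimately show ?case by (intro bexI[of _ W]) auto
qed

lemma nested_ckr_subset:
  assumes "nested_ckr X T P" "n \<le> N" "U \<in> kr_atoms X T (P N)" "V \<in> kr_atoms X T (P n)"
    "x \<in> U" "x \<in> V"
  shows "U \<subseteq> V"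
proof -
  obtain W where W: "W \<in> kr_atoms X T (P n)" "U \<subseteq> W"
    using nested_ckr_refine[OF assms(1-3)] by blast
  moreover have "ckr_partition X T (P n)" using assms(1) by (simp add: nested_ckr_def)
  ultimately have "W = V" using kr_atoms_unique assms(4-6) by (metis subsetD)
  then show ?thesis using W by simp
qed

text \<open>Two atoms with a common point both contain the atom of that point in the later of their
  two partitions, so the generating atoms form a basis and not just a subbasis.\<close>

lemma nested_ckr_basis:
  assumes P: "nested_ckr X T P" and U: "openin X U" "x \<in> U"
  shows "\<exists>n. \<exists>V\<in>kr_atoms X T (P n). x \<in> V \<and> V \<subseteq> U"
proof -
  have ckr: "ckr_partition X T (P n)" for n using P by (simp add: nested_ckr_def)
  have "generate_topology_on (\<Union>n. kr_atoms X T (P n)) U"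
    using P U(1) unfolding nested_ckr_def by (metis openin_topology_generated_by)
  then show ?thesis using U(2)
  proof (induction arbitrary: x)
    case (Int a b)
    obtain n V where V: "V \<in> kr_atoms X T (P n)" "x \<in> V" "V \<subseteq> a" using Int by blast
    obtain m W where W: "W \<in> kr_atoms X T (P m)" "x \<in> W" "W \<subseteq> b" using Int by blast
    have "x \<in> topspace X" using V(1,2) ckr[of n] unfolding ckr_partition_def by blast
    then obtain C where C: "C \<in> kr_atoms X T (P (max n m))" "x \<in> C"
      using ckr[of "max n m"] unfolding ckr_partition_def by blast
    have "C \<subseteq> V"
      by (rule nested_ckr_subset[OF P max.cobounded1 C(1) V(1) C(2) V(2)])
    moreover have "C \<subseteq> W"
      by (rule nested_ckr_subset[OF P max.cobounded2 C(1) W(1) C(2) W(2)])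
    ultimately show ?case using C V(3) W(3) by (intro exI[of _ "max n m"] bexI[of _ C]) auto
  next
    case (UN K)
    then obtain k where k: "k \<in> K" "x \<in> k" by blast
    from UN.IH[OF this] obtain n V where "V \<in> kr_atoms X T (P n)" "x \<in> V" "V \<subseteq> k" by blast
    then show ?case using k(1) by (intro exI[of _ n] bexI[of _ V]) auto
  next
    case (Basis s)
    then obtain n where "s \<in> kr_atoms X T (P n)" by blast
    then show ?case using Basis by (intro exI[of _ n] bexI[of _ s]) auto
  qed simp
qed

text \<open>The atoms on which the locally constant \<open>f\<close> is constant form an open cover.
  By compactness finitely many suffice, and the atoms of the latest partition involved lie inside
  these.\<close>

lemma nested_ckr_separates:
  assumes P: "nested_ckr X T P" and "compact_space X"
    and f: "\<And>x. x \<in> topspace X \<Longrightarrow> openin X {y \<in> topspace X. f y = f x}"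
  shows "\<exists>n. \<forall>V\<in>kr_atoms X T (P n). \<forall>x\<in>V. \<forall>y\<in>V. f x = f y"
proof -
  have ckr: "ckr_partition X T (P n)" for n using P by (simp add: nested_ckr_def)
  define F where "F = {V. (\<exists>n. V \<in> kr_atoms X T (P n)) \<and> (\<forall>x\<in>V. \<forall>y\<in>V. f x = f y)}"
  have "openin X V" if "V \<in> F" for V
  proof -
    have "openin (topology_generated_by (\<Union>n. kr_atoms X T (P n))) V"
      using that by (intro topology_generated_by_Basis) (auto simp: F_def)
    then show ?thesis using P unfolding nested_ckr_def by metis
  qed
  moreover have "topspace X \<subseteq> \<Union>F"
  proof
    fix x assume x: "x \<in> topspace X"
    then obtain n V where V: "V \<in> kr_atoms X T (P n)" "x \<in> V" "V \<subseteq> {y \<in> topspace X. f y = f x}"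
      using nested_ckr_basis[OF P f[OF x], of x] by auto
    from V(3) have "\<forall>y\<in>V. f y = f x" by blast
    then have "V \<in> F" using V(1) unfolding F_def by auto
    then show "x \<in> \<Union>F" using \<open>x \<in> V\<close> by blast
  qed
  ultimately obtain G where G: "finite G" "G \<subseteq> F" "topspace X \<subseteq> \<Union>G"
    using \<open>compact_space X\<close> unfolding compact_space_alt by meson
  have "\<forall>V\<in>G. \<exists>n. V \<in> kr_atoms X T (P n)" using G(2) by (auto simp: F_def)
  then obtain lv where lv: "\<And>V. V \<in> G \<Longrightarrow> V \<in> kr_atoms X T (P (lv V))" by metis
  define N where "N = Max (insert 0 (lv ` G))"
  have N: "lv V \<le> N" if "V \<in> G" for V
    unfolding N_def using G(1) that by (intro Max_ge) auto
  have "f x = f y" if "W \<in> kr_atoms X T (P N)" "x \<in> W" "y \<in> W" for W x y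
  proof -
    have "x \<in> topspace X" using that ckr[of N] unfolding ckr_partition_def by blast
    then obtain V where V: "V \<in> G" "x \<in> V" using G(3) by blast
    have "W \<subseteq> V"
      by (rule nested_ckr_subset[OF P N[OF V(1)] that(1) lv[OF V(1)] that(2) V(2)])
    then show ?thesis using V that G(2) by (auto simp: F_def)
  qed
  then show ?thesis by blast
qed

text \<open>A partition with a single tower is a partition into the residue classes of the return time,
  so a shift-invariant space with such separating partitions is periodic.\<close>

lemma not_rank_at_most_1:
  assumes "\<forall>k. \<exists>n. k < complexity stair_shift n"
  shows "\<not> rank_at_most stair_top shift 1"
proof
  assume "rank_at_most stair_top shift 1"
  then obtain P where P: "nested_ckr stair_top shift P" "\<And>n. ntowers (P n) \<le> 1"
    by (auto simp: rank_at_most_def)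
  have "compact_space stair_top" using cantor_stair_shift[OF assms] by (simp add: cantor_space_def)
  moreover have "openin stair_top {y \<in> topspace stair_top. y 0 = x 0}" for x
    unfolding topspace_stair_top by (rule clopen_local[of 0]) auto
  ultimately obtain n where n: "\<And>V x y. V \<in> kr_atoms stair_top shift (P n) \<Longrightarrow> x \<in> V \<Longrightarrow> y \<in> V \<Longrightarrow> x 0 = y 0"
    using nested_ckr_separates[OF P(1), of "\<lambda>x. x 0"] by blast
  have ckr: "ckr_partition stair_top shift (P n)" using P by (simp add: nested_ckr_def)
  have "ntowers (P n) \<noteq> 0"
  proof
    assume "ntowers (P n) = 0"
    then have "kr_atoms stair_top shift (P n) = {}" by (auto simp: kr_atoms_def kr_indices_def)
    then have "topspace stair_top = {}" using ckr unfolding ckr_partition_def by simp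
    then show False using base_pt_stair_shift by auto
  qed
  then have 1: "ntowers (P n) = 1" using P(2)[of n] by linarith
  define B h where "B = base (P n) 1" and "h = height (P n) 1"
  have h: "1 \<le> h" and Bh: "iterate_vimage stair_top shift h B = B"
    using ckr 1 by (auto simp: ckr_partition_def B_def h_def kr_base_def)
  \<comment> \<open>Since the base equals its preimage under the \<open>h\<close>-th shift, the
    \<open>h\<close>-th shift maps each atom of the single tower into itself; so \<open>x\<close>
    and its image share the letter at 0.\<close>
  have step: "x (int h) = x 0" if x: "x \<in> stair_shift" for x
  proof -
    have "\<Union> (kr_atoms stair_top shift (P n)) = stair_shift"
      using ckr by (simp add: ckr_partition_def)
    then obtain V where V: "V \<in> kr_atoms stair_top shift (P n)" "x \<in> V" using x by blast
    then obtain j where j: "V = iterate_vimage stair_top shift j B"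
      by (auto simp: kr_atoms_def kr_indices_def 1 B_def)
    have "(shift ^^ j) x \<in> iterate_vimage stair_top shift h B"
      using V(2) j Bh by (simp add: iterate_vimage_def)
    then have "(shift ^^ h) ((shift ^^ j) x) \<in> B" by (simp add: iterate_vimage_def)
    then have "(shift ^^ j) ((shift ^^ h) x) \<in> B" by (metis add.commute funpow_add o_apply)
    then have "(shift ^^ h) x \<in> V" using x by (simp add: j iterate_vimage_def shift_pow_stair_shift)
    then show ?thesis using n[OF V(1) V(2)] by (simp add: shift_pow)
  qed
  have un: "(unshift ^^ k) x \<in> stair_shift" if "x \<in> stair_shift" for k x
    using that unshift_stair_shift by (induction k) auto
  have unp: "(unshift ^^ k) x i = x (i - int k)" for k x i
    by (induction k arbitrary: i) (auto simp: unshift_def algebra_simps)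
  \<comment> \<open>Applying \<open>step\<close> to the shifts of \<open>base_pt\<close> in both
    directions gives the period at every coordinate.\<close>
  have "base_pt (i + int h) = base_pt i" for i
  proof (cases "0 \<le> i")
    case True
    then show ?thesis using step[OF shift_pow_stair_shift[OF base_pt_stair_shift, of "nat i"]]
      by (simp add: shift_pow add.commute)
  next
    case False
    then show ?thesis using step[OF un[OF base_pt_stair_shift, of "nat (- i)"]]
      by (simp add: unp add.commute)
  qed
  then have "(shift ^^ h) base_pt = base_pt" by (auto simp: shift_pow)
  then have "complexity stair_shift m \<le> h" for m
    using periodic_complexity[OF base_pt_stair_shift] h by simp
  then show False using assms by (meson not_le)
qed


section \<open>Superlinear complexity\<close>

lemma finite_words: "finite (words stair_shift m)"
proof -
  have "words stair_shift m \<subseteq> {w. set w \<subseteq> {0, 1} \<and> length w = m}"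
    unfolding words_stair_shift stair_lang_def using set_mono_sublist set_block by blast
  then show ?thesis using finite_lists_length_eq[of "{0, 1::nat}" m] finite_subset by blast
qed

lemma stair_lang_extend:
  assumes "w \<in> stair_lang"
  shows "\<exists>a. w @ [a] \<in> stair_lang"
proof -
  obtain k where "window base_pt (0 + int k) (length w) = w"
    using stair_lang_recurrent[OF assms] base_pt_stair_shift by blast
  then have "window base_pt (int k) (length w + 1) = w @ [base_pt (int k + int (length w))]"
    unfolding window_add by (simp add: window_def)
  moreover have "window base_pt (int k) (length w + 1) \<in> stair_lang"
    using base_pt_stair_shift unfolding stair_shift_def by blast
  ultimately show ?thesis by metis
qed

text \<open>Choose one right extension \<open>e w\<close> for every word of length \<open>m\<close>
  and a second one \<open>f w\<close> for every word in \<open>R\<close>; the resulting words of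
  length \<open>m + 1\<close> are all distinct.\<close>

lemma complexity_right_special:
  assumes "R \<subseteq> words stair_shift m"
    "\<And>w. w \<in> R \<Longrightarrow> \<exists>a b. a \<noteq> b \<and> w @ [a] \<in> stair_lang \<and> w @ [b] \<in> stair_lang"
  shows "complexity stair_shift m + card R \<le> complexity stair_shift (Suc m)"
proof -
  have "\<forall>w\<in>words stair_shift m. \<exists>a. w @ [a] \<in> stair_lang"
    using stair_lang_extend by (auto simp: words_stair_shift)
  then obtain e where e: "\<And>w. w \<in> words stair_shift m \<Longrightarrow> w @ [e w] \<in> stair_lang" by metis
  have "\<exists>b. b \<noteq> e w \<and> w @ [b] \<in> stair_lang" if w: "w \<in> R" for w
  proof -
    obtain a b where "a \<noteq> b" "w @ [a] \<in> stair_lang" "w @ [b] \<in> stair_lang"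
      using assms(2)[OF w] by (elim exE conjE)
    then show ?thesis by metis
  qed
  then have "\<forall>w\<in>R. \<exists>b. b \<noteq> e w \<and> w @ [b] \<in> stair_lang" by (intro ballI)
  from bchoice[OF this] obtain f where f: "\<And>w. w \<in> R \<Longrightarrow> f w \<noteq> e w \<and> w @ [f w] \<in> stair_lang" by auto
  let ?E = "(\<lambda>w. w @ [e w]) ` words stair_shift m" and ?F = "(\<lambda>w. w @ [f w]) ` R"
  have card: "card ?E = complexity stair_shift m" "card ?F = card R"
    unfolding complexity_def by (intro card_image inj_onI; simp)+
  have disj: "?E \<inter> ?F = {}" by (auto dest: f)
  have fin: "finite ?E" "finite ?F" using finite_words finite_subset[OF assms(1)] by auto
  have "complexity stair_shift m + card R = card (?E \<union> ?F)"
    using card_Un_disjoint[OF fin disj] card by simp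
  also have "\<dots> \<le> complexity stair_shift (Suc m)" unfolding complexity_def
  proof (rule card_mono[OF finite_words])
    show "?E \<union> ?F \<subseteq> words stair_shift (Suc m)"
      using e f assms(1) unfolding words_stair_shift by auto
  qed
  finally show ?thesis .
qed

text \<open>An occurrence of \<open>v\<close> in \<open>u\<close> would, by
  \<open>block_rigid\<close>, put \<open>True\<close> into the list \<open>[False]\<close>.\<close>

lemma block_not_suffix: "\<not> suffix (block n True) (block n False)"
proof
  assume "suffix (block n True) (block n False)"
  then obtain p where "expand n [False] = p @ block n True @ []" by (auto simp: suffix_def)
  from block_rigid[OF this] show False by (auto simp: Cons_eq_append_conv)
qed

text \<open>By rigidity neither block is a prefix of the other, so they part after a common prefix
  \<open>z\<close>. The two letters found there provide the two right extensions.\<close>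

lemma block_first_difference:
  "\<exists>z a b p q. a \<noteq> b \<and> block n False = z @ a # p \<and> block n True = z @ b # q"
proof (rule parallel_decomp[of "block n False" "block n True", THEN exE])
  have *: "\<not> prefix (block n True) (block n False)"
  proof
    assume "prefix (block n True) (block n False)"
    then obtain q where "expand n [False] = [] @ block n True @ q" by (auto simp: prefix_def)
    from block_rigid[OF this] show False by (auto simp: Cons_eq_append_conv)
  qed
  moreover have "\<not> prefix (block n False) (block n True)"
  proof
    assume "prefix (block n False) (block n True)"
    then have "block n False = block n True"
      using length_block_le[of n] by (auto simp: prefix_def)
    then show False using * by simp
  qed
  ultimately show "block n False \<parallel> block n True" by blast
qed blast

section \<open>Powers of the short block and right special words\<close>

definition word_power :: "'a list \<Rightarrow> nat \<Rightarrow> 'a list" where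
  "word_power v k = concat (replicate k v)"

lemma word_power_simps [simp]: "word_power v 0 = []"
  "word_power v (Suc k) = v @ word_power v k" "length (word_power v k) = k * length v"
  by (auto simp: word_power_def length_concat sum_list_replicate)

lemma word_power_add: "word_power v (i + j) = word_power v i @ word_power v j"
  by (simp add: word_power_def replicate_add)

lemma word_power_Suc_right: "word_power v (Suc i) = word_power v i @ v"
  using word_power_add[of v i 1] by simp

lemma word_power_suffix: "i \<le> j \<Longrightarrow> suffix (word_power v i) (word_power v j)"
  by (auto simp: suffix_def le_iff_add word_power_add add.commute)

lemma word_power_prefix: "i \<le> j \<Longrightarrow> prefix (word_power v i) (word_power v j)"
  by (auto simp: prefix_def le_iff_add word_power_add)

lemma expand_word_power: "expand n (replicate k c) = word_power (block n c) k"
  by (simp add: word_power_def)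

text \<open>In the staircase the runs of \<open>k + 1\<close> and \<open>k + 2\<close> copies of
  \<open>v\<close> are followed by \<open>u\<close>; this is the extension by \<open>u\<close>. For
  the extension by \<open>v\<close>, take the runs of \<open>k + 2\<close> and \<open>k + 3\<close>
  copies and drop one \<open>v\<close> on the left.\<close>

lemma stair_extensions:
  assumes "k + 3 \<le> stair_len n"
    "G = word_power (block n True) (Suc k) @ block n False @ word_power (block n True) (Suc (Suc k))"
  shows "G @ block n c \<in> stair_lang"
proof -
  have "prefix (stair (Suc (Suc (Suc k)))) (stair (stair_len n))"
    using assms(1) by (intro prefix_stair) simp
  then have st: "sublist (stair (Suc (Suc (Suc k)))) (stair_subst (stair_len n) False)"
    by (auto simp: stair_subst_def sublist_Cons_right)
  let ?g = "replicate (Suc k) True @ False # replicate (Suc (Suc k)) True"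
  have "sublist (?g @ [c]) (stair (Suc (Suc (Suc k))))"
  proof (cases c)
    case True
    have "?g @ [c] = replicate (Suc k) True @ False # replicate (Suc (Suc (Suc k))) True"
      using True by (simp add: replicate_append_same)
    moreover have "stair (Suc (Suc (Suc k))) = (stair k @ False # replicate (Suc k) True @ [False, True])
      @ (replicate (Suc k) True @ False # replicate (Suc (Suc (Suc k))) True) @ []"
      by (simp add: replicate_append_same)
    ultimately show ?thesis unfolding sublist_def by metis
  next
    case False
    have "stair (Suc (Suc (Suc k))) = (stair k @ [False]) @ (?g @ [c]) @ replicate (Suc (Suc (Suc k))) True"
      using False by simp
    then show ?thesis unfolding sublist_def by metis
  qed
  then have "sublist (expand n (?g @ [c])) (block (Suc n) False)"
    using st sublist_expand[of "?g @ [c]"] unfolding block_Suc by (metis sublist_order.order.trans)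
  moreover have "expand n (?g @ [c]) = G @ block n c"
    unfolding assms(2) by (simp add: word_power_def)
  ultimately show ?thesis using block_stair_lang stair_lang_sublist by metis
qed

text \<open>The right special words used here are the suffixes of \<open>v^(k+1) u v^(k+2) z\<close>, where \<open>u\<close> and
  \<open>v\<close> are the long and the short block of level \<open>n\<close> and \<open>z\<close> is their longest common prefix.\<close>

lemma complexity_step:
  assumes "2 * (n + 3) * length (block n True) \<le> m" "m \<le> stair_len n * length (block n True)"
  shows "complexity stair_shift m + n \<le> complexity stair_shift (Suc m)"
proof -
  define u v where "u = block n False" and "v = block n True"
  define s where "s = length v"
  have s: "0 < s" and sl: "s \<le> length u"
    using length_block_le[of n] by (auto simp: s_def u_def v_def)
  obtain z a b p q where z: "a \<noteq> b" "u = z @ a # p" "v = z @ b # q"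
    using block_first_difference[of n] by (auto simp: u_def v_def)
  have lz: "length z < s" using z(3) by (simp add: s_def)
  define Q where "Q = m div s"
  have Q: "Q * s \<le> m" "m < Suc Q * s"
    unfolding Q_def using s by (auto simp: dividend_less_div_times)
  have Q1: "2 * (n + 3) \<le> Q" "Q \<le> stair_len n"
    using div_le_mono[OF assms(1), of s] div_le_mono[OF assms(2), of s] s
    unfolding Q_def s_def v_def by (simp_all del: mult_Suc)
  \<comment> \<open>The lower end makes \<open>G k @ z\<close> at least \<open>m\<close> letters
    long, so that \<open>w k\<close> has length \<open>m\<close>. The upper end makes
    \<open>w k\<close> longer than \<open>v^(k+3) z\<close>, which is what separates different
    \<open>k\<close>.\<close>
  define I where "I = {Q div 2..<Q - 3}"
  have cardI: "n \<le> card I" using Q1 unfolding I_def by simp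
  define G where "G = (\<lambda>k. word_power v (Suc k) @ u @ word_power v (Suc (Suc k)))"
  define w where "w = (\<lambda>k. drop (length (G k) + length z - m) (G k @ z))"
  have I: "(k + 4) * s \<le> m" "m \<le> (2 * k + 3) * s" "k + 3 \<le> stair_len n" if "k \<in> I" for k
  proof -
    have k: "k + 4 \<le> Q" "Suc Q \<le> 2 * k + 3" using that unfolding I_def by auto
    show "(k + 4) * s \<le> m" using mult_le_mono1[OF k(1), of s] Q(1) by linarith
    show "m \<le> (2 * k + 3) * s" using mult_le_mono1[OF k(2), of s] Q(2) by linarith
    show "k + 3 \<le> stair_len n" using k Q1 by linarith
  qed
  have lw: "length (w k) = m" "suffix (w k) (G k @ z)" if "k \<in> I" for k
  proof -
    have "length (G k) = (2 * k + 3) * s + length u"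
      unfolding G_def by (simp add: s_def algebra_simps)
    then show "length (w k) = m" using I(2)[OF that] by (simp add: w_def)
    show "suffix (w k) (G k @ z)" unfolding w_def by (rule suffix_drop)
  qed
  have stair_lang: "w k @ [a] \<in> stair_lang" "w k @ [b] \<in> stair_lang" if "k \<in> I" for k
  proof -
    have *: "w k @ [c] \<in> stair_lang" if "G k @ z @ c # r \<in> stair_lang" for c r
    proof -
      obtain t where "G k @ z = t @ w k" using lw(2)[OF \<open>k \<in> I\<close>] by (auto simp: suffix_def)
      then have "G k @ z @ c # r = t @ (w k @ [c]) @ r"
        by (metis append.assoc append_Cons append_Nil)
      then show ?thesis using that stair_lang_sublist by (metis sublist_appendI)
    qed
    have "G k @ block n c \<in> stair_lang" for c
      by (rule stair_extensions[OF I(3)[OF that]]) (simp add: G_def u_def v_def)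
    from this[of False] this[of True] show "w k @ [a] \<in> stair_lang" "w k @ [b] \<in> stair_lang"
      using * z(2,3) by (auto simp: u_def v_def)
  qed
  \<comment> \<open>For \<open>k < l\<close> the word \<open>w l\<close> ends with
    \<open>v^(k+3) z\<close>. If it equalled \<open>w k\<close>, a suffix of
    \<open>v^(k+1) u v^(k+2) z\<close>, then \<open>v\<close> would be a suffix of
    \<open>u\<close>.\<close>
  have ne: "w k \<noteq> w l" if kl: "k \<in> I" "l \<in> I" "k < l" for k l
  proof
    assume eq: "w k = w l"
    let ?t = "word_power v (Suc (Suc k)) @ z"
    have "suffix (v @ ?t) (G l @ z)"
      using word_power_suffix[of "Suc (Suc (Suc k))" "Suc (Suc l)" v] kl(3)
      unfolding G_def by (auto simp: suffix_def)
    moreover have "length (v @ ?t) \<le> length (w l)"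
      using I(1)[OF kl(1)] lz lw(1)[OF kl(2)] by (simp add: s_def algebra_simps)
    ultimately have "suffix (v @ ?t) (w l)"
      using lw(2)[OF kl(2)] suffix_length_suffix by blast
    then have "suffix (v @ ?t) ((word_power v (Suc k) @ u) @ ?t)"
      using lw(2)[OF kl(1)] eq suffix_order.trans unfolding G_def by fastforce
    then have "suffix v (word_power v (Suc k) @ u)" by (simp only: same_suffix_suffix)
    moreover have "suffix u (word_power v (Suc k) @ u)" by (simp add: suffix_def)
    ultimately have "suffix v u" using sl suffix_length_suffix unfolding s_def by blast
    then show False using block_not_suffix by (simp add: u_def v_def)
  qed
  have "inj_on w I"
    using ne by (intro linorder_inj_onI) auto
  then have "card (w ` I) = card I" by (rule card_image)
  moreover have "complexity stair_shift m + card (w ` I) \<le> complexity stair_shift (Suc m)"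
  proof (rule complexity_right_special)
    show "w ` I \<subseteq> words stair_shift m"
      using stair_lang lw(1) stair_lang_sublist unfolding words_stair_shift by blast
    show "\<exists>a b. a \<noteq> b \<and> x @ [a] \<in> stair_lang \<and> x @ [b] \<in> stair_lang" if "x \<in> w ` I" for x
      using that stair_lang z(1) by blast
  qed
  ultimately show ?thesis using cardI by linarith
qed

text \<open>Without a bracket, \<open>f n \<le> m\<close> would pass from each \<open>n\<close> to
  the next, against \<open>n \<le> f n\<close>. This selects the level of the construction that
  governs a given length.\<close>

lemma threshold_bracket:
  fixes f :: "nat \<Rightarrow> nat"
  assumes "\<And>n. n \<le> f n" "f N \<le> m"
  shows "\<exists>n\<ge>N. f n \<le> m \<and> m < f (Suc n)"
proof (rule ccontr)
  assume *: "\<not> ?thesis"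
  have "f n \<le> m" if "N \<le> n" for n
    using that by (induction rule: dec_induct) (use assms(2) * in \<open>auto simp: not_less\<close>)
  from this[of "N + m + 1"] assms(1)[of "N + m + 1"] show False by simp
qed

text \<open>The ranges of lengths served by \<open>complexity_step\<close> at successive levels
  overlap: by the choice of \<open>stair_len\<close>, \<open>2 * (n + 4)\<close> short blocks of
  level \<open>n + 1\<close> have at most \<open>stair_len n\<close> letters in total. So some level
  \<open>n \<ge> N\<close> serves \<open>m\<close>.\<close>

lemma complexity_increment:
  assumes "2 * (N + 3) * length (block N True) \<le> m"
  shows "complexity stair_shift m + N \<le> complexity stair_shift (Suc m)"
proof -
  let ?f = "\<lambda>n. 2 * (n + 3) * length (block n True)"
  have "n \<le> ?f n" for n
  proof -
    have "n \<le> 2 * (n + 3) * 1" by simp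
    also have "\<dots> \<le> ?f n" by (intro mult_le_mono2) (simp add: Suc_le_eq)
    finally show ?thesis .
  qed
  from threshold_bracket[of ?f, OF this assms] obtain n
    where n: "N \<le> n" "?f n \<le> m" "m < ?f (Suc n)" by blast
  have "?f (Suc n) \<le> stair_len n"
    unfolding stair_len_def length_block_True_Suc by (simp add: algebra_simps)
  also have "\<dots> * 1 \<le> stair_len n * length (block n True)"
    by (intro mult_le_mono2) (simp add: Suc_le_eq)
  finally have "m \<le> stair_len n * length (block n True)" using n(3) by simp
  from complexity_step[OF n(2) this] n(1) show ?thesis by linarith
qed

lemma complexity_lower: "\<exists>M. \<forall>m\<ge>M. N * (m - M) \<le> complexity stair_shift m"
proof -
  let ?M = "2 * (N + 3) * length (block N True)"
  have "N * (m - ?M) \<le> complexity stair_shift m" if "?M \<le> m" for m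
    using that
  proof (induction m rule: dec_induct)
    case (step m)
    then show ?case using complexity_increment[OF step.hyps(1)] by (simp add: Suc_diff_le)
  qed simp
  then show ?thesis by blast
qed

lemma liminf_complexity: "liminf (\<lambda>n. ereal (real (complexity stair_shift n) / real n)) = \<infinity>"
proof -
  have "(\<lambda>n. ereal (real (complexity stair_shift n) / real n)) \<longlonglongrightarrow> \<infinity>"
    unfolding tendsto_PInfty
  proof
    fix r :: real
    \<comment> \<open>The factor 2 compensates for replacing \<open>m - M\<close> by its lower bound
      \<open>m / 2\<close>.\<close>
    obtain N :: nat where N: "2 * \<bar>r\<bar> < real N" using reals_Archimedean2 by blast
    obtain M where M: "\<And>m. M \<le> m \<Longrightarrow> N * (m - M) \<le> complexity stair_shift m"
      using complexity_lower by blast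
    have "ereal r < ereal (real (complexity stair_shift m) / real m)" if m: "2 * M + 1 \<le> m" for m
    proof -
      have "r * real m < (real N / 2) * real m" using N m by (intro mult_strict_right_mono) auto
      also have "\<dots> = real N * (real m / 2)" by simp
      also have "\<dots> \<le> real N * real (m - M)" using m by (intro mult_left_mono) auto
      also have "\<dots> = real (N * (m - M))" by simp
      also have "\<dots> \<le> real (complexity stair_shift m)" using M[of m] m by (simp only: of_nat_le_iff)
      finally show ?thesis using m by (simp add: field_simps)
    qed
    then show "\<forall>\<^sub>F n in sequentially. ereal r < ereal (real (complexity stair_shift n) / real n)"
      unfolding eventually_sequentially by blast
  qed
  then show ?thesis by (intro lim_imp_Liminf) auto
qed

lemma complexity_unbounded: "\<exists>n. k < complexity stair_shift n"
proof -
  obtain M where "\<And>m. M \<le> m \<Longrightarrow> Suc k * (m - M) \<le> complexity stair_shift m"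
    using complexity_lower by blast
  from this[of "Suc M"] show ?thesis by (intro exI[of _ "Suc M"]) simp
qed


section \<open>Subquadratic complexity\<close>

lemma sublist_append_suffix:
  assumes "sublist w (A @ B)" "suffix Z A" "length w \<le> length Z"
  shows "sublist w A \<or> sublist w (Z @ B)"
proof -
  consider "sublist w A" | "sublist w B" | w1 w2 where "w = w1 @ w2" "suffix w1 A" "prefix w2 B"
    using assms(1) by (auto simp: sublist_append)
  then show ?thesis
  proof cases
    case 2
    then show ?thesis by (simp add: sublist_append)
  next
    case 3
    then have "suffix w1 Z" using assms(2,3) suffix_length_suffix by (metis length_append add_leD1)
    then show ?thesis using 3 by (auto simp: sublist_append)
  qed simp
qed

lemma sublist_append_prefix:
  assumes "sublist w (A @ B)" "prefix Z B" "length w \<le> length Z"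
  shows "sublist w B \<or> sublist w (A @ Z)"
proof -
  consider "sublist w A" | "sublist w B" | w1 w2 where "w = w1 @ w2" "suffix w1 A" "prefix w2 B"
    using assms(1) by (auto simp: sublist_append)
  then show ?thesis
  proof cases
    case 1
    then show ?thesis by (simp add: sublist_append)
  next
    case 3
    then have "prefix w2 Z" using assms(2,3) prefix_length_prefix by (metis length_append add_leD2)
    then show ?thesis using 3 by (auto simp: sublist_append)
  qed simp
qed

lemma sublist_mono:
  "suffix A A' \<Longrightarrow> prefix B B' \<Longrightarrow> sublist w (A @ C @ B) \<Longrightarrow> sublist w (A' @ C @ B')"
proof -
  assume "suffix A A'" "prefix B B'" "sublist w (A @ C @ B)"
  then obtain P S where "A' = P @ A" "B' = B @ S" by (auto simp: suffix_def prefix_def)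
  then have "sublist (A @ C @ B) (A' @ C @ B')"
    unfolding sublist_def by (intro exI[of _ P] exI[of _ S]) simp
  then show ?thesis using \<open>sublist w (A @ C @ B)\<close> sublist_order.order.trans by blast
qed

text \<open>A factor may begin inside a copy of \<open>v\<close>, whence one copy more than its
  length requires.\<close>

lemma sublist_word_power:
  assumes "sublist w (word_power v i)" "length w \<le> K * length v"
  shows "sublist w (word_power v (Suc K))"
  using assms(1)
proof (induction i)
  case (Suc i)
  show ?case
  proof (cases "Suc i \<le> Suc K")
    case True
    then show ?thesis using Suc.prems word_power_prefix[of "Suc i" "Suc K" v]
      by (meson prefix_imp_sublist sublist_order.order.trans)
  next
    case False
    then have "suffix (word_power v K) (word_power v i)" by (intro word_power_suffix) simp
    moreover have "sublist w (word_power v i @ v)"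
      using Suc.prems by (simp only: word_power_Suc_right)
    ultimately show ?thesis
      using sublist_append_suffix[of w "word_power v i" v "word_power v K"] assms(2) Suc.IH
      by (auto simp only: word_power_Suc_right word_power_simps)
  qed
qed (simp add: word_power_def)

lemma sublist_word_power_right:
  assumes "sublist w (A @ word_power v i)" "length w \<le> K * length v"
  shows "sublist w (A @ word_power v (Suc K))"
proof (cases "i \<le> Suc K")
  case True
  then show ?thesis
    using sublist_mono[of "[]"
      "[]" "word_power v i" "word_power v (Suc K)" w A] assms(1) word_power_prefix[OF True, of v]
    by (simp del: word_power_simps)
next
  case False
  then have "prefix (word_power v (Suc K)) (word_power v i)" by (intro word_power_prefix) simp
  from sublist_append_prefix[OF assms(1) this] assms(2)
  have "sublist w (word_power v i) \<or> sublist w (A @ word_power v (Suc K))" by simp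
  then show ?thesis using sublist_word_power[OF _ assms(2)] by (auto simp: sublist_append)
qed

lemma sublist_word_power_left:
  assumes "sublist w (word_power v i @ B)" "length w \<le> K * length v"
  shows "sublist w (word_power v (Suc K) @ B)"
proof (cases "i \<le> Suc K")
  case True
  then show ?thesis
    using sublist_mono[of "word_power v i"
      "word_power v (Suc K)" "[]" "[]" w B] assms(1) word_power_suffix[OF True, of v]
    by (simp del: word_power_simps)
next
  case False
  then have "suffix (word_power v (Suc K)) (word_power v i)" by (intro word_power_suffix) simp
  from sublist_append_suffix[OF assms(1) this] assms(2)
  have "sublist w (word_power v i) \<or> sublist w (word_power v (Suc K) @ B)" by simp
  then show ?thesis
  proof
    assume "sublist w (word_power v i)"
    from sublist_word_power[OF this assms(2)] show ?thesis
      by (rule sublist_order.order.trans) (rule sublist_append_rightI)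
  qed
qed

text \<open>Induction on the height. For \<open>a > K\<close>, a word that meets the new part
  \<open>u v^(a+1)\<close> cannot reach back beyond the run \<open>v^a\<close> before it. It then
  lies in some \<open>v^i u v^j\<close>, whose exponents can be cut to \<open>K + 1\<close>.\<close>

lemma sublist_stair:
  assumes "sublist w (expand n (False # stair a))" "length w \<le> K * length (block n True)"
  shows "sublist w (expand n (False # stair (Suc K))) \<or>
    sublist w (word_power (block n True) (Suc K) @ block n False @ word_power (block n True) (Suc K))"
  using assms(1)
proof (induction a)
  case 0
  have "sublist (expand n (False # stair 0)) (expand n (False # stair (Suc K)))"
    by (intro sublist_expand) auto
  then show ?case using 0 sublist_order.order.trans by blast
next
  case (Suc a)
  let ?u = "block n False" and ?v = "block n True"
  show ?case
  proof (cases "Suc a \<le> Suc K")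
    case True
    then have "sublist (expand n (False # stair (Suc a))) (expand n (False # stair (Suc K)))"
      using prefix_stair[of "Suc a" "Suc K"]
        by (intro sublist_expand) (simp add: prefix_imp_sublist del: stair.simps)
    then show ?thesis using Suc.prems sublist_order.order.trans by blast
  next
    case False
    then obtain b where b: "a = Suc b" by (cases a) auto
    have eq: "expand n (False # stair (Suc a)) = expand n (False # stair a) @ ?u @ word_power ?v (Suc a)"
      by (simp add: word_power_def)
    have "expand n (False # stair a) = (?u @ expand n (stair b) @ ?u) @ word_power ?v a"
      by (simp add: word_power_def b)
    then have "suffix (word_power ?v a) (expand n (False # stair a))" unfolding suffix_def by blast
    moreover have "suffix (word_power ?v K) (word_power ?v a)"
      using False by (intro word_power_suffix) simp
    ultimately have "suffix (word_power ?v K) (expand n (False # stair a))"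
      using suffix_order.trans by blast
    from sublist_append_suffix[OF Suc.prems[unfolded eq] this] assms(2)
    consider "sublist w (expand n (False # stair a))" | "sublist w (word_power ?v K @ ?u @ word_power ?v (Suc a))"
      by auto
    then show ?thesis
    proof cases
      case 1
      then show ?thesis by (rule Suc.IH)
    next
      case 2
      from sublist_word_power_left[OF 2 assms(2)]
      have "sublist w ((word_power ?v (Suc K) @ ?u) @ word_power ?v (Suc a))"
        by (simp only: append.assoc)
      from sublist_word_power_right[OF this assms(2)]
      have "sublist w (word_power ?v (Suc K) @ ?u @ word_power ?v (Suc K))"
        by (simp only: append.assoc)
      then show ?thesis by (rule disjI2)
    qed
  qed
qed

lemma length_expand_stair:
  "length (expand n (stair a)) \<le> a * (length (block n False) + a * length (block n True))"
proof (induction a)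
  case (Suc a)
  have "length (expand n (stair (Suc a)))
      = length (expand n (stair a)) + (length (block n False) + Suc a * length (block n True))"
    by (simp add: sum_list_replicate length_concat)
  also have "length (expand n (stair a)) \<le> a * (length (block n False) + Suc a * length (block n True))"
    using Suc by (rule order_trans) simp
  finally show ?case by simp
qed simp

section \<open>Counting factors\<close>

definition factors :: "nat \<Rightarrow> 'a list \<Rightarrow> 'a list set" where
  "factors m W = {w. sublist w W \<and> length w = m}"

lemma card_factors:
  assumes "0 < m"
  shows "card (factors m W) \<le> length W" "finite (factors m W)"
proof -
  let ?I = "(\<lambda>k. take m (drop k W)) ` {..<length W}"
  have stair_subst: "factors m W \<subseteq> ?I"
  proof
    fix w assume "w \<in> factors m W"
    then obtain p q where w: "W = p @ w @ q" "length w = m" by (auto simp: factors_def sublist_def)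
    then show "w \<in> (\<lambda>k. take m (drop k W)) ` {..<length W}"
      using assms by (intro image_eqI[of _ _ "length p"]) auto
  qed
  then show "finite (factors m W)" by (rule finite_subset) simp
  have "card (factors m W) \<le> card ?I" using stair_subst by (intro card_mono) auto
  also have "\<dots> \<le> card {..<length W}" by (rule card_image_le) simp
  finally show "card (factors m W) \<le> length W" by simp
qed

text \<open>With \<open>K * s\<close> between \<open>m\<close> and \<open>2 * m\<close>,
  \<open>sublist_stair\<close> replaces the huge long block by two words whose lengths are of order
  at most \<open>m\<^sup>2 / s\<close>. Each has at most as many factors of length \<open>m\<close>
  as letters.\<close>

lemma card_factors_block:
  assumes "length (block n False) \<le> m"
  shows "length (block n True) * card (factors m (block (Suc n) False)) \<le> 20 * m\<^sup>2"
proof -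
  define s l where "s = length (block n True)" and "l = length (block n False)"
  define K where "K = m div s + 1"
  have s: "0 < s" "s \<le> l" "l \<le> m" using assms length_block_le[of n] by (auto simp: s_def l_def)
  have "K * s = m div s * s + s" "m div s * s \<le> m" by (simp_all add: K_def)
  moreover have "m < K * s" unfolding K_def using s by (simp add: dividend_less_div_times)
  ultimately have K: "K * s \<le> 2 * m" "m \<le> K * s" "Suc K * s \<le> 3 * m"
    using s unfolding mult_Suc by linarith+
  let ?A = "expand n (False # stair (Suc K))"
  let ?B = "word_power (block n True) (Suc K) @ block n False @ word_power (block n True) (Suc K)"
  have "factors m (block (Suc n) False) \<subseteq> factors m ?A \<union> factors m ?B"
  proof
    fix w assume w: "w \<in> factors m (block (Suc n) False)"
    have "block (Suc n) False = expand n (False # stair (stair_len n))"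
      by (simp add: block_Suc stair_subst_def)
    then show "w \<in> factors m ?A \<union> factors m ?B"
      using sublist_stair[of w n "stair_len n" K] w K(2) unfolding factors_def s_def by auto
  qed
  moreover have m: "0 < m" using s by simp
  ultimately have "card (factors m (block (Suc n) False)) \<le> card (factors m ?A \<union> factors m ?B)"
    using card_factors(2)[OF m] by (intro card_mono) auto
  also have "\<dots> \<le> length ?A + length ?B"
    using card_Un_le card_factors(1)[OF m] add_mono order_trans by meson
  also have "\<dots> \<le> (l + Suc K * (l + Suc K * s)) + (2 * (Suc K * s) + l)"
    using length_expand_stair[of n "Suc K"] by (simp add: l_def s_def del: stair.simps)
  finally have "s * card (factors m (block (Suc n) False))
      \<le> s * ((l + Suc K * (l + Suc K * s)) + (2 * (Suc K * s) + l))"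
    by (rule mult_le_mono2)
  also have "\<dots> = s * (l + l + 2 * (Suc K * s)) + (Suc K * s) * (l + Suc K * s)"
    by (simp add: algebra_simps)
  also have "\<dots> \<le> m * (m + m + 2 * (3 * m)) + 3 * m * (m + 3 * m)"
  proof (rule add_le_mono)
    show "s * (l + l + 2 * (Suc K * s)) \<le> m * (m + m + 2 * (3 * m))"
      by (rule mult_le_mono) (use s K(3) in linarith)+
    show "(Suc K * s) * (l + Suc K * s) \<le> 3 * m * (m + 3 * m)"
      by (rule mult_le_mono[OF K(3)]) (use s K(3) in linarith)
  qed
  also have "\<dots> = 20 * m\<^sup>2" by (simp add: power2_eq_square algebra_simps)
  finally show ?thesis by (simp add: s_def)
qed

text \<open>Take a concatenation of the fewest blocks that contains \<open>w\<close>. If an inner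
  block were \<open>u\<close>, the inner part would be at least as long as \<open>w\<close>, and the
  first or the last block could be dropped. So all inner blocks are \<open>v\<close>.\<close>

lemma expand_window_cases:
  assumes "sublist w (expand n B)" "length w \<le> length (block n False)"
  shows "\<exists>i. sublist w (block n False @ word_power (block n True) i @ block n False)"
proof -
  let ?u = "block n False" and ?v = "block n True"
  obtain C where C: "sublist w (expand n C)"
    and min: "\<And>D. sublist w (expand n D) \<Longrightarrow> length C \<le> length D"
    using ex_has_least_nat[of "\<lambda>B. sublist w (expand n B)" B length] assms(1) by blast
  have pref: "sublist (word_power ?v i) (?u @ word_power ?v i @ ?u)"
    "sublist (?u @ word_power ?v i) (?u @ word_power ?v i @ ?u)"
    "sublist (word_power ?v i @ ?u) (?u @ word_power ?v i @ ?u)" for i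
    using sublist_appendI[of "word_power ?v i" ?u ?u] sublist_append_rightI[of "?u @ word_power ?v i" ?u]
      sublist_append_leftI[of "word_power ?v i @ ?u" ?u] by (simp_all del: sublist_appendI)
  \<comment> \<open>Outer blocks equal to \<open>v\<close> are absorbed into the run, and the
    missing \<open>u\<close> is added outside.\<close>
  have block: "\<exists>i. sublist w (?u @ word_power ?v i @ ?u)"
    if "sublist w (block n c @ word_power ?v j @ block n d)" for c d j
  proof (cases c; cases d)
    assume "c" "d"
    then have "sublist w (word_power ?v (Suc (Suc j)))"
      using that
        by (simp add: word_power_Suc_right[symmetric] del: word_power_simps) (simp add: word_power_Suc_right)
    then show ?thesis using pref(1) sublist_order.order.trans by blast
  next
    assume "c" "\<not> d"
    then have "sublist w (word_power ?v (Suc j) @ ?u)" using that by simp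
    then show ?thesis using pref(3) sublist_order.order.trans by blast
  next
    assume "\<not> c" "d"
    then have "sublist w (?u @ word_power ?v (Suc j))"
      using that by (simp only: word_power_Suc_right)
    then show ?thesis using pref(2) sublist_order.order.trans by blast
  next
    assume "\<not> c" "\<not> d"
    then show ?thesis using that by auto
  qed
  consider "C = []" | c where "C = [c]" | c D d where "C = c # D @ [d]"
    by (cases C; cases "tl C" rule: rev_cases) auto
  then show ?thesis
  proof cases
    case 1
    then show ?thesis using C by simp
  next
    case 2
    then have "sublist w (block n c @ word_power ?v 0 @ block n True)"
      using C by (simp add: sublist_append)
    then show ?thesis by (rule block)
  next
    case 3
    have n1: "\<not> sublist w (expand n (c # D))" using min[of "c # D"] 3 by auto
    have n2: "\<not> sublist w (expand n (D @ [d]))" using min[of "D @ [d]"] 3 by auto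
    have "False \<notin> set D"
    proof
      assume "False \<in> set D"
      then obtain D1 D2 where D: "D = D1 @ False # D2" by (meson split_list)
      then have "length ?u \<le> length (expand n D)" by simp
      moreover have "sublist w (block n c @ expand n D) \<or> sublist w (expand n D @ block n d)"
        using sublist_append_suffix[of w "block n c @ expand n D"
          "block n d" "expand n D"] C 3 assms(2) calculation
        by (auto simp: suffix_def)
      ultimately show False using n1 n2 by simp
    qed
    then have "D = replicate (length D) True"
      by (metis (full_types) replicate_eqI)
    then have "expand n D = word_power ?v (length D)" using expand_word_power by metis
    then have "sublist w (block n c @ word_power ?v (length D) @ block n d)" using C 3 by simp
    then show ?thesis by (rule block)
  qed
qed

text \<open>When the run is longer than \<open>w\<close>, the word meets at most one of the outer
  \<open>u\<close>, and the run can be cut.\<close>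

lemma expand_window_bounded:
  assumes "sublist w (u @ word_power v i @ u)" "length w \<le> K * length v"
  shows "\<exists>i\<le>Suc K. sublist w (u @ word_power v i @ u)"
proof (cases "i \<le> Suc K")
  case False
  then have "suffix (word_power v K) (u @ word_power v i)"
    using word_power_suffix[of K i v] by (simp add: suffix_appendI)
  from sublist_append_suffix[of w "u @ word_power v i" u, OF _ this] assms
  have "sublist w (u @ word_power v i) \<or> sublist w (word_power v K @ u)" by simp
  then show ?thesis
  proof
    assume "sublist w (u @ word_power v i)"
    from sublist_word_power_right[OF this assms(2)] have "sublist w ((u @ word_power v (Suc K)) @ u)"
      by (subst sublist_append) simp
    then show ?thesis by (intro exI[of _ "Suc K"]) simp
  next
    assume "sublist w (word_power v K @ u)"
    then show ?thesis by (intro exI[of _ K]) (simp add: sublist_append)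
  qed
qed (use assms in auto)

text \<open>This replaces the length of \<open>u\<close> by \<open>m\<close> in the words to be
  searched, at the price of the factors of \<open>u\<close> itself.\<close>

lemma sublist_trim:
  assumes "sublist w (u @ Y @ u)" "length w = m" "m \<le> length u"
  shows "sublist w u \<or> sublist w (drop (length u - m) u @ Y @ take m u)"
proof -
  have "sublist w u \<or> sublist w (drop (length u - m) u @ Y @ u)"
    using sublist_append_suffix[OF assms(1) suffix_drop, of "length u - m"] assms(2,3) by simp
  moreover have "sublist w u \<or> sublist w (drop (length u - m) u @ Y @ take m u)"
    if "sublist w (drop (length u - m) u @ Y @ u)"
    using sublist_append_prefix[of w "drop (length u - m) u @ Y" u "take m u"] that assms(2,3)
    by (simp add: take_is_prefix)
  ultimately show ?thesis by blast
qed

text \<open>Let \<open>u'\<close> and \<open>v'\<close> be the blocks of level \<open>n + 1\<close>.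
  A word of length \<open>m\<close> is a factor of \<open>u'\<close>, counted by
  \<open>card_factors_block\<close>, or of one of the \<open>K + 2\<close> trimmed words
  \<open>Y i\<close> around powers of \<open>v'\<close>. Since \<open>s \<le> t\<close>, the factor
  \<open>s\<close> turns the number of these words into a multiple of \<open>m\<close>.\<close>

lemma complexity_upper:
  assumes "length (block n False) \<le> m" "m \<le> length (block (Suc n) False)"
  shows "length (block n True) * complexity stair_shift m \<le> 200 * m\<^sup>2"
proof -
  let ?u = "block (Suc n) False" and ?v = "block (Suc n) True"
  define s l t where "s = length (block n True)" and "l = length (block n False)"
    and "t = length ?v"
  have t: "t = 2 * l + 2 * s" by (simp add: t_def s_def l_def length_block_True_Suc)
  have s: "0 < s" "s \<le> l" "l \<le> m" "0 < t" "t \<le> 4 * m" "s \<le> t"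
    using assms length_block_le[of n] t by (auto simp: s_def l_def)
  have m: "0 < m" using s by simp
  define K where "K = m div t + 1"
  have "K * t = m div t * t + t" "m div t * t \<le> m" by (simp_all add: K_def)
  moreover have "m < K * t" unfolding K_def using s by (simp add: dividend_less_div_times)
  ultimately have K: "K * t \<le> m + t" "m \<le> K * t" by linarith+
  define Y where "Y = (\<lambda>i. drop (length ?u - m) ?u @ word_power ?v i @ take m ?u)"
  have "words stair_shift m \<subseteq> factors m ?u \<union> (\<Union>i\<in>{..Suc K}. factors m (Y i))"
  proof
    fix w assume "w \<in> words stair_shift m"
    then have w: "w \<in> stair_lang" "length w = m" by (auto simp: words_stair_shift)
    obtain B where "sublist w (expand (Suc n) B)" using stair_lang_expand[OF w(1)] by blast
    then obtain j where "sublist w (?u @ word_power ?v j @ ?u)"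
      using expand_window_cases[of w "Suc n" B] w(2) assms(2) by auto
    from expand_window_bounded[OF this, of K] w(2) K(2)
    obtain i where i: "i \<le> Suc K" "sublist w (?u @ word_power ?v i @ ?u)" by (auto simp: t_def)
    from sublist_trim[OF i(2) w(2) assms(2)] show "w \<in> factors m ?u \<union> (\<Union>i\<in>{..Suc K}. factors m (Y i))"
      using i(1) w(2) unfolding factors_def Y_def by blast
  qed
  then have "complexity stair_shift m \<le> card (factors m ?u \<union> (\<Union>i\<in>{..Suc K}. factors m (Y i)))"
    unfolding complexity_def using card_factors(2)[OF m] by (intro card_mono) auto
  also have "\<dots> \<le> card (factors m ?u) + card (\<Union>i\<in>{..Suc K}. factors m (Y i))" by (rule card_Un_le)
  also have "card (\<Union>i\<in>{..Suc K}. factors m (Y i)) \<le> (\<Sum>i\<in>{..Suc K}. card (factors m (Y i)))"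
    by (intro card_UN_le) simp
  also have "\<dots> \<le> (\<Sum>i\<in>{..Suc K}. 2 * m + Suc K * t)"
  proof (intro sum_mono)
    fix i assume "i \<in> {..Suc K}"
    then have "i * t \<le> Suc K * t" by (intro mult_le_mono1) simp
    then have "length (Y i) \<le> 2 * m + Suc K * t"
      using assms(2) unfolding Y_def t_def by simp
    then show "card (factors m (Y i)) \<le> 2 * m + Suc K * t"
      using card_factors(1)[OF m] order_trans by blast
  qed
  also have "\<dots> = (K + 2) * (2 * m + Suc K * t)" by simp
  finally have "complexity stair_shift m \<le> card (factors m ?u) + (K + 2) * (2 * m + Suc K * t)"
    by simp
  then have "s * complexity stair_shift m \<le> s * (card (factors m ?u) + (K + 2) * (2 * m + Suc K * t))"
    by (rule mult_le_mono2)
  also have "\<dots> = s * card (factors m ?u) + (s * (K + 2)) * (2 * m + Suc K * t)"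
    by (rule trans[OF distrib_left]) (simp only: mult.assoc)
  \<comment> \<open>From \<open>K * t \<le> m + t\<close> and \<open>t \<le> 4 * m\<close> come
    \<open>s * (K + 2) \<le> m + 3 * t \<le> 13 * m\<close> and
    \<open>Suc K * t \<le> m + 2 * t \<le> 9 * m\<close>.\<close>
  also have "\<dots> \<le> 20 * m\<^sup>2 + (13 * m) * (2 * m + 9 * m)"
  proof (rule add_le_mono)
    show "s * card (factors m ?u) \<le> 20 * m\<^sup>2"
      unfolding s_def using card_factors_block[OF assms(1)] .
    have "s * (K + 2) \<le> t * (K + 2)" using s(6) by (rule mult_le_mono1)
    also have "\<dots> = K * t + 2 * t" by (simp add: algebra_simps)
    finally have "s * (K + 2) \<le> 13 * m" using K(1) s(5) by linarith
    moreover have "2 * m + Suc K * t \<le> 2 * m + 9 * m"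
      unfolding mult_Suc using K(1) s(5) by linarith
    ultimately show "s * (K + 2) * (2 * m + Suc K * t) \<le> 13 * m * (2 * m + 9 * m)"
      by (rule mult_le_mono)
  qed
  also have "\<dots> \<le> 200 * m\<^sup>2" by (simp add: power2_eq_square)
  finally show ?thesis by (simp add: s_def)
qed

text \<open>At the level bracketing \<open>m\<close>, \<open>complexity_upper\<close> bounds the
  quotient by 200 divided by the length of \<open>v\<close>, which exceeds the level and so tends to
  infinity with \<open>m\<close>.\<close>

lemma complexity_subquadratic: "(\<lambda>n. real (complexity stair_shift n) / (real n)\<^sup>2) \<longlonglongrightarrow> 0"
proof (rule LIMSEQ_I)
  fix r :: real assume r: "0 < r"
  obtain N :: nat where N: "200 / r < real N" using reals_Archimedean2 by blast
  have "norm (real (complexity stair_shift m) / (real m)\<^sup>2 - 0) < r"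
    if m: "length (block N False) \<le> m" for m
  proof -
    let ?l = "\<lambda>n. length (block n False)"
    have "n \<le> ?l n" for n using length_block_ge[of n False] by simp
    from threshold_bracket[of ?l, OF this m] obtain n where n: "N \<le> n" "?l n \<le> m" "m < ?l (Suc n)"
      by blast
    let ?s = "length (block n True)"
    have "?s * complexity stair_shift m \<le> 200 * m\<^sup>2" using n by (intro complexity_upper) auto
    then have c: "real ?s * real (complexity stair_shift m) \<le> 200 * (real m)\<^sup>2"
      by (metis of_nat_le_iff of_nat_mult of_nat_numeral of_nat_power)
    have s: "200 / r < real ?s" using N n(1) length_block_ge[of n True] by simp
    then have s0: "0 < real ?s" using r by (smt (verit) divide_pos_pos)
    have m0: "0 < real m" using m length_block_ge[of N False] by simp
    have "real (complexity stair_shift m) / (real m)\<^sup>2 \<le> 200 / real ?s"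
      using c s0 m0 by (simp add: field_simps)
    also have "\<dots> < r" using s s0 r by (simp add: field_simps)
    finally show ?thesis by simp
  qed
  then show "\<exists>no. \<forall>n\<ge>no. norm (real (complexity stair_shift n) / (real n)\<^sup>2 - 0) < r" by blast
qed

theorem proposition6p19:
  shows "\<exists>(A :: nat set) (X :: (int \<Rightarrow> nat) set).
     subshift A X \<and>
     minimal_cantor_system (subtopology (full_shift A) X) shift \<and>
     finite_topological_rank (subtopology (full_shift A) X) shift \<and>
     topological_rank (subtopology (full_shift A) X) shift = 2 \<and>
     liminf (\<lambda>n. ereal (real (complexity X n) / real n)) = \<infinity> \<and>
     (\<lambda>n. real (complexity X n) / (real n)\<^sup>2) \<longlonglongrightarrow> 0"
proof (intro exI conjI)
  have unbounded: "\<forall>k. \<exists>n. k < complexity stair_shift n" using complexity_unbounded by blast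
  show "subshift {0, 1} stair_shift" by (rule subshift_stair_shift)
  show "minimal_cantor_system (subtopology (full_shift {0, 1}) stair_shift) shift"
    using cantor_stair_shift[OF unbounded] minimal_stair_shift
    by (simp only: minimal_cantor_system_def stair_top_def)
  show "finite_topological_rank (subtopology (full_shift {0, 1}) stair_shift) shift"
    using rank_at_most_2 unfolding finite_topological_rank_def stair_top_def by blast
  have "topological_rank stair_top shift = 2"
    unfolding topological_rank_def
  proof (rule Least_equality)
    fix d assume d: "rank_at_most stair_top shift d"
    show "2 \<le> d"
    proof (rule ccontr)
      assume "\<not> 2 \<le> d"
      then have "d \<le> 1" by simp
      \<comment> \<open>\<open>rank_at_most\<close> only bounds the number of towers, so it passes
        to larger bounds; this also disposes of \<open>d = 0\<close>.\<close>
      then have "rank_at_most stair_top shift 1"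
        using d unfolding rank_at_most_def by (meson order_trans)
      then show False using not_rank_at_most_1[OF unbounded] by simp
    qed
  qed (rule rank_at_most_2)
  then show "topological_rank (subtopology (full_shift {0, 1}) stair_shift) shift = 2"
    by (simp only: stair_top_def)
qed (rule liminf_complexity complexity_subquadratic)+

end
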